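(* Let $T>0$ and $\Omega=[0,1]$. Let $(v,u,\theta,Z)$ be a generalised solution on $[0,T]\times[0,1]$ to the one-dimensional dynamic combustion system with initial data $(v_0,u_0,\theta_0,Z_0)$ and the initial-boundary conditions (all specified in the context), where in addition $(v_0,u_0,\theta_0,Z_0)\in[H^1([0,1])]^4$ and $v_0\in W^{1,\infty}([0,1])$. Then the entropy of $Z$ with respect to the Lebesgue measure on $[0,1]$, $$\mathrm{Ent}(Z):=\int_0^1Z\log Z\,\mathrm{d}y-\left(\int_0^1Z\,\mathrm{d}y\right)\log\left(\int_0^1Z\,\mathrm{d}y\right),$$ is bounded from above on $[0,T]$ by a uniform constant depending only on $a,q,m_0,M_0,D,K,\mu,\nu$, on $T$, on $\|\phi\|_{L^\infty}$, and on the norm $\|(v_0,u_0,\theta_0,Z_0)\|_{[H^1([0,1])\cap W^{1,\infty}([0,1])]\times[H^1([0,1])]^3}$.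
   Context: System (Lagrangian coordinates $(t,y)$, $\Omega=[0,1]$): for $(v,u,\theta,Z):[0,T]\times\Omega\to\mathbb{R}^4$, $$\begin{cases} v_t-u_y=0,\\ u_t+\left(\frac{a\theta}{v}\right)_y=\left(\frac{\mu u_y}{v}\right)_y,\\ \left(\theta+\frac{u^2}{2}\right)_t+\left(\frac{au\theta}{v}\right)_y=\left(\frac{\mu uu_y}{v}\right)_y+\left(\frac{\nu\theta_y}{v}\right)_y+qK\phi(\theta)Z,\\ Z_t+K\phi(\theta)Z=\left(\frac{D}{v^2}Z_y\right)_y.\end{cases}$$ Here $v=1/\rho$ is the specific volume ($\rho$ the density), $u$ the velocity, $\theta$ the temperature, $Z$ the mass fraction of the reactant; $a,\mu,\nu,q,K,D$ are positive constants. The reaction rate function is $\phi(\theta)=\theta^{\alpha}e^{-A/\theta}$ for $\theta>\theta_{\rm ignite}$ and $\phi(\theta)=0$ for $\theta<\theta_{\rm ignite}$, with constants $\theta_{\rm ignite}>0$, $A>0$, $\alpha\in\mathbb{R}$ such that $\phi\in L^\infty(]0,\infty[)$ ($\phi$ has a jump at $\theta_{\rm ignite}$). Initial-boundary conditions: $(v,u,\theta,Z)|_{t=0}=(v_0,u_0,\theta_0,Z_0)$ on $\Omega$; $(u,\theta_y,Z_y)|_{\partial\Omega}=0$ for all $t\in[0,T]$; with $\rho_0=1/v_0$, there are constants $m_0,M_0$ with $0<m_0\le\rho_0,\theta_0\le M_0<\infty$, and $0\le Z_0\le1$ on $\Omega$. The data satisfy the compatibility conditions $\big(u_0,(\theta_0)_y,(Z_0)_y,\,a\rho_0\theta_0-[\mu(u_0)_y]_y\big)\big|_{\partial\Omega}=0$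 and are normalised by $\int_0^1v_0\,\mathrm{d}y=1$. Generalised solution: $(v,u,\theta,Z)$ such that (i) the system holds almost everywhere on $[0,T]\times\Omega$; (ii) $(u,\theta-1,Z)\in L^\infty(0,T;H^1(\Omega))\cap L^2(0,T;H^2(\Omega))$, $(v_t,u_t,\theta_t,Z_t)\in L^2(0,T;L^2(\Omega))$, and $v^{-1}-1\in L^\infty(0,T;H^1(\Omega))$; (iii) the initial conditions hold in the sense of trace in these function spaces. $Z$ is identified with its continuous-in-time representative, lying in $\bigcap_{\gamma\in[0,1[}C^0([0,T];H^\gamma(\Omega))$. Convention: $0\log0=0$. *)

theory Defs
  imports "HOL-Analysis.Analysis" "HOL-Probability.Essential_Supremum"
begin

section \<open>Lebesgue and Sobolev spaces on an interval\<close>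

text \<open>
  Elements of the function spaces are represented by Borel measurable functions; except for
  \<open>L2_continuous\<close>, which singles out a representative for every time, the notions below do not
  depend on the choice of the representatives.
\<close>

definition Linf :: "real set \<Rightarrow> (real \<Rightarrow> real) \<Rightarrow> bool" where
  "Linf S f \<longleftrightarrow> set_borel_measurable lborel S f \<and> (\<exists>C. AE x\<in>S in lborel. \<bar>f x\<bar> \<le> C)"

definition Linf_norm :: "real set \<Rightarrow> (real \<Rightarrow> real) \<Rightarrow> real" where
  "Linf_norm S f = real_of_ereal (esssup (restrict_space lborel S) (\<lambda>x. ereal \<bar>f x\<bar>))"

definition L2 :: "real set \<Rightarrow> (real \<Rightarrow> real) \<Rightarrow> bool" where
  "L2 S f \<longleftrightarrow> set_borel_measurable lborel S f \<and> set_integrable lborel S (\<lambda>x. (f x)\<^sup>2)"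

definition test_function :: "real \<Rightarrow> real \<Rightarrow> (real \<Rightarrow> real) \<Rightarrow> bool" where
  "test_function a b \<psi> \<longleftrightarrow>
     (\<forall>n. (deriv ^^ n) \<psi> differentiable_on UNIV) \<and>
     (\<exists>c d. a < c \<and> d < b \<and> (\<forall>x. x \<notin> {c..d} \<longrightarrow> \<psi> x = 0))"

definition has_weak_deriv :: "real \<Rightarrow> real \<Rightarrow> (real \<Rightarrow> real) \<Rightarrow> (real \<Rightarrow> real) \<Rightarrow> bool" where
  "has_weak_deriv a b f g \<longleftrightarrow>
     set_integrable lborel {a..b} f \<and> set_integrable lborel {a..b} g \<and>
     (\<forall>\<psi>. test_function a b \<psi> \<longrightarrow>
        (LINT x:{a..b}|lborel. f x * deriv \<psi> x) = - (LINT x:{a..b}|lborel. g x * \<psi> x))"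

text \<open>The weak derivative on \<open>\<Omega> = [0,1]\<close>; unique up to null sets when it exists.\<close>

definition weak_deriv :: "(real \<Rightarrow> real) \<Rightarrow> real \<Rightarrow> real" where
  "weak_deriv f = (SOME g. has_weak_deriv 0 1 f g)"

text \<open>The Hilbert spaces \<open>H\<^sup>k(\<Omega>)\<close>, with \<open>H\<^sup>0 = L\<^sup>2\<close>, and their norms.\<close>

primrec Hk :: "nat \<Rightarrow> (real \<Rightarrow> real) \<Rightarrow> bool" where
  "Hk 0 f \<longleftrightarrow> L2 {0..1} f"
| "Hk (Suc k) f \<longleftrightarrow> L2 {0..1} f \<and> (\<exists>g. has_weak_deriv 0 1 f g \<and> Hk k g)"

definition Hk_norm :: "nat \<Rightarrow> (real \<Rightarrow> real) \<Rightarrow> real" where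
  "Hk_norm k f = sqrt (\<Sum>j\<le>k. LINT y:{0..1}|lborel. ((weak_deriv ^^ j) f y)\<^sup>2)"

definition W1inf :: "(real \<Rightarrow> real) \<Rightarrow> bool" where
  "W1inf f \<longleftrightarrow> Linf {0..1} f \<and> (\<exists>g. has_weak_deriv 0 1 f g \<and> Linf {0..1} g)"

definition W1inf_norm :: "(real \<Rightarrow> real) \<Rightarrow> real" where
  "W1inf_norm f = Linf_norm {0..1} f + Linf_norm {0..1} (weak_deriv f)"

text \<open>
  Boundary value at an endpoint \<open>x\<close> of \<open>]a,b[\<close>, as an essential limit from inside the interval.
  For functions in \<open>H\<^sup>1\<close> this is the trace, that is, the value at \<open>x\<close> of the continuous
  representative.
\<close>

definition has_boundary_value ::
  "real \<Rightarrow> real \<Rightarrow> (real \<Rightarrow> real) \<Rightarrow> real \<Rightarrow> real \<Rightarrow> bool" where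
  "has_boundary_value a b f x c \<longleftrightarrow>
     (\<forall>e>0. \<exists>d>0. AE y\<in>{a<..<b} in lborel. \<bar>y - x\<bar> < d \<longrightarrow> \<bar>f y - c\<bar> < e)"

section \<open>Functions of time and space\<close>

text \<open>Functions on \<open>[0,T] \<times> \<Omega>\<close> are written \<open>f t y\<close>.\<close>

definition cyl :: "real \<Rightarrow> (real \<times> real) set" where
  "cyl T = {0..T} \<times> {0..1}"

definition cyl_measurable :: "real \<Rightarrow> (real \<Rightarrow> real \<Rightarrow> real) \<Rightarrow> bool" where
  "cyl_measurable T f \<longleftrightarrow> set_borel_measurable lborel (cyl T) (\<lambda>(t, y). f t y)"

text \<open>
  The Bochner spaces \<open>L\<^sup>\<infinity>(0,T;H\<^sup>k(\<Omega>))\<close> and \<open>L\<^sup>2(0,T;H\<^sup>k(\<Omega>))\<close>. As \<open>H\<^sup>k(\<Omega>)\<close> is separable, joint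
  measurability together with \<open>f t \<in> H\<^sup>k\<close> for a.e. \<open>t\<close> amounts to strong measurability of
  \<open>t \<mapsto> f t\<close>. The lower integral \<open>\<integral>\<^sup>+\<close> is used since \<^const>\<open>Hk_norm\<close> is unspecified
  on the null set of times where \<open>f t \<notin> H\<^sup>k\<close>.
\<close>

definition Linf_Hk :: "real \<Rightarrow> nat \<Rightarrow> (real \<Rightarrow> real \<Rightarrow> real) \<Rightarrow> bool" where
  "Linf_Hk T k f \<longleftrightarrow> cyl_measurable T f \<and>
     (AE t\<in>{0..T} in lborel. Hk k (f t)) \<and>
     (\<exists>C. AE t\<in>{0..T} in lborel. Hk_norm k (f t) \<le> C)"

definition L2_Hk :: "real \<Rightarrow> nat \<Rightarrow> (real \<Rightarrow> real \<Rightarrow> real) \<Rightarrow> bool" where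
  "L2_Hk T k f \<longleftrightarrow> cyl_measurable T f \<and>
     (AE t\<in>{0..T} in lborel. Hk k (f t)) \<and>
     (\<integral>\<^sup>+ t\<in>{0..T}. ennreal ((Hk_norm k (f t))\<^sup>2) \<partial>lborel) < \<infinity>"

text \<open>
  \<open>f\<^sub>t = g\<close> as vector-valued distributions on \<open>]0,T[\<close>: \<open>\<integral> \<psi>' f dt = - \<integral> \<psi> g dt\<close>, an identity between
  functions of \<open>y\<close>.
\<close>

definition has_dt :: "real \<Rightarrow> (real \<Rightarrow> real \<Rightarrow> real) \<Rightarrow> (real \<Rightarrow> real \<Rightarrow> real) \<Rightarrow> bool" where
  "has_dt T f g \<longleftrightarrow>
     set_integrable lborel (cyl T) (\<lambda>(t, y). f t y) \<and>
     set_integrable lborel (cyl T) (\<lambda>(t, y). g t y) \<and>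
     (\<forall>\<psi>. test_function 0 T \<psi> \<longrightarrow>
        (AE y\<in>{0..1} in lborel.
           (LINT t:{0..T}|lborel. f t y * deriv \<psi> t) = - (LINT t:{0..T}|lborel. g t y * \<psi> t)))"

definition has_dy :: "real \<Rightarrow> (real \<Rightarrow> real \<Rightarrow> real) \<Rightarrow> (real \<Rightarrow> real \<Rightarrow> real) \<Rightarrow> bool" where
  "has_dy T f g \<longleftrightarrow> cyl_measurable T f \<and> cyl_measurable T g \<and>
     (AE t\<in>{0..T} in lborel. has_weak_deriv 0 1 (f t) (g t))"

definition L2_continuous :: "real \<Rightarrow> (real \<Rightarrow> real \<Rightarrow> real) \<Rightarrow> bool" where
  "L2_continuous T f \<longleftrightarrow>
     (\<forall>t\<in>{0..T}. L2 {0..1} (f t)) \<and>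
     (\<forall>t\<in>{0..T}. ((\<lambda>s. LINT y:{0..1}|lborel. (f s y - f t y)\<^sup>2) \<longlongrightarrow> 0) (at t within {0..T}))"

text \<open>Trace at \<open>t = 0\<close>: the continuous-in-time representative of \<open>f\<close> starts at \<open>f\<^sub>0\<close>.\<close>

definition has_initial_trace :: "real \<Rightarrow> (real \<Rightarrow> real \<Rightarrow> real) \<Rightarrow> (real \<Rightarrow> real) \<Rightarrow> bool" where
  "has_initial_trace T f f0 \<longleftrightarrow>
     (\<exists>F. L2_continuous T F \<and>
          (AE p\<in>cyl T in lborel. F (fst p) (snd p) = f (fst p) (snd p)) \<and>
          (AE y\<in>{0..1} in lborel. F 0 y = f0 y))"

section \<open>The combustion system\<close>

text \<open>
  The value at the jump is left open by the definition of the reaction rate; any value between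
  the two one-sided limits is admitted.
\<close>

definition reaction_rate :: "real \<Rightarrow> real \<Rightarrow> real \<Rightarrow> (real \<Rightarrow> real) \<Rightarrow> bool" where
  "reaction_rate \<alpha> A \<theta>ign \<phi> \<longleftrightarrow>
     (\<forall>\<theta>>\<theta>ign. \<phi> \<theta> = \<theta> powr \<alpha> * exp (- A / \<theta>)) \<and>
     (\<forall>\<theta><\<theta>ign. \<phi> \<theta> = 0) \<and>
     0 \<le> \<phi> \<theta>ign \<and> \<phi> \<theta>ign \<le> \<theta>ign powr \<alpha> * exp (- A / \<theta>ign)"

text \<open>
  The system almost everywhere, each derivative occurring in it being a weak one. The condition
  \<open>v \<noteq> 0\<close> is implicit in the quotients, which are total functions here.
\<close>

definition combustion_system ::
  "real \<Rightarrow> real \<Rightarrow> real \<Rightarrow> real \<Rightarrow> real \<Rightarrow> real \<Rightarrow> (real \<Rightarrow> real) \<Rightarrow> real \<Rightarrow>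
   (real \<Rightarrow> real \<Rightarrow> real) \<Rightarrow> (real \<Rightarrow> real \<Rightarrow> real) \<Rightarrow> (real \<Rightarrow> real \<Rightarrow> real) \<Rightarrow> (real \<Rightarrow> real \<Rightarrow> real) \<Rightarrow> bool"
where
  "combustion_system a \<mu> \<nu> q K D \<phi> T v u \<theta> Z \<longleftrightarrow>
     (AE p\<in>cyl T in lborel. v (fst p) (snd p) \<noteq> 0) \<and>
     (\<exists>v_t u_t E_t Z_t u_y \<theta>_y Z_y pres_y visc_y work_y viscwork_y heat_y diff_y.
        has_dt T v v_t \<and>
        has_dt T u u_t \<and>
        has_dt T (\<lambda>t y. \<theta> t y + (u t y)\<^sup>2 / 2) E_t \<and>
        has_dt T Z Z_t \<and>
        has_dy T u u_y \<and>
        has_dy T \<theta> \<theta>_y \<and>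
        has_dy T Z Z_y \<and>
        has_dy T (\<lambda>t y. a * \<theta> t y / v t y) pres_y \<and>
        has_dy T (\<lambda>t y. \<mu> * u_y t y / v t y) visc_y \<and>
        has_dy T (\<lambda>t y. a * u t y * \<theta> t y / v t y) work_y \<and>
        has_dy T (\<lambda>t y. \<mu> * u t y * u_y t y / v t y) viscwork_y \<and>
        has_dy T (\<lambda>t y. \<nu> * \<theta>_y t y / v t y) heat_y \<and>
        has_dy T (\<lambda>t y. D / (v t y)\<^sup>2 * Z_y t y) diff_y \<and>
        (AE p\<in>cyl T in lborel. case p of (t, y) \<Rightarrow>
           v_t t y - u_y t y = 0 \<and>
           u_t t y + pres_y t y = visc_y t y \<and>
           E_t t y + work_y t y = viscwork_y t y + heat_y t y + q * K * \<phi> (\<theta> t y) * Z t y \<and>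
           Z_t t y + K * \<phi> (\<theta> t y) * Z t y = diff_y t y))"

definition generalised_solution ::
  "real \<Rightarrow> real \<Rightarrow> real \<Rightarrow> real \<Rightarrow> real \<Rightarrow> real \<Rightarrow> (real \<Rightarrow> real) \<Rightarrow> real \<Rightarrow>
   (real \<Rightarrow> real) \<Rightarrow> (real \<Rightarrow> real) \<Rightarrow> (real \<Rightarrow> real) \<Rightarrow> (real \<Rightarrow> real) \<Rightarrow>
   (real \<Rightarrow> real \<Rightarrow> real) \<Rightarrow> (real \<Rightarrow> real \<Rightarrow> real) \<Rightarrow> (real \<Rightarrow> real \<Rightarrow> real) \<Rightarrow> (real \<Rightarrow> real \<Rightarrow> real) \<Rightarrow> bool"
where
  "generalised_solution a \<mu> \<nu> q K D \<phi> T v0 u0 \<theta>0 Z0 v u \<theta> Z \<longleftrightarrow>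
     combustion_system a \<mu> \<nu> q K D \<phi> T v u \<theta> Z \<and>
     (\<forall>f \<in> {u, \<lambda>t y. \<theta> t y - 1, Z}. Linf_Hk T 1 f \<and> L2_Hk T 2 f) \<and>
     (\<forall>f \<in> {v, u, \<theta>, Z}. \<exists>f_t. has_dt T f f_t \<and> L2_Hk T 0 f_t) \<and>
     Linf_Hk T 1 (\<lambda>t y. inverse (v t y) - 1) \<and>
     has_initial_trace T v v0 \<and> has_initial_trace T u u0 \<and>
     has_initial_trace T \<theta> \<theta>0 \<and> has_initial_trace T Z Z0"

text \<open>
  The derivatives \<open>\<theta>\<^sub>y\<close> and \<open>Z\<^sub>y\<close> lie in \<open>L\<^sup>2(0,T;H\<^sup>1)\<close>, so their traces on \<open>\<partial>\<Omega> = {0,1}\<close>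
  exist for a.e. \<open>t\<close>.
\<close>

definition boundary_conditions ::
  "real \<Rightarrow> (real \<Rightarrow> real \<Rightarrow> real) \<Rightarrow> (real \<Rightarrow> real \<Rightarrow> real) \<Rightarrow> (real \<Rightarrow> real \<Rightarrow> real) \<Rightarrow> bool" where
  "boundary_conditions T u \<theta> Z \<longleftrightarrow>
     (AE t\<in>{0..T} in lborel. \<forall>x\<in>{0, 1}.
        has_boundary_value 0 1 (u t) x 0 \<and>
        has_boundary_value 0 1 (weak_deriv (\<theta> t)) x 0 \<and>
        has_boundary_value 0 1 (weak_deriv (Z t)) x 0)"

text \<open>
  For \<open>H\<^sup>1\<close> data the quantities \<open>(\<theta>\<^sub>0)\<^sub>y\<close>, \<open>(Z\<^sub>0)\<^sub>y\<close> and \<open>[\<mu>(u\<^sub>0)\<^sub>y]\<^sub>y\<close> need not have traces, so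
  the compatibility conditions include that they do. No regularity away from \<open>\<partial>\<Omega>\<close> is imposed: the
  second derivative only has to exist on some interval \<open>]c,d[\<close> adjacent to the boundary point.
\<close>

definition compatible_data ::
  "real \<Rightarrow> real \<Rightarrow> (real \<Rightarrow> real) \<Rightarrow> (real \<Rightarrow> real) \<Rightarrow> (real \<Rightarrow> real) \<Rightarrow> (real \<Rightarrow> real) \<Rightarrow> bool" where
  "compatible_data a \<mu> v0 u0 \<theta>0 Z0 \<longleftrightarrow>
     (\<forall>x\<in>{0, 1}.
        has_boundary_value 0 1 u0 x 0 \<and>
        has_boundary_value 0 1 (weak_deriv \<theta>0) x 0 \<and>
        has_boundary_value 0 1 (weak_deriv Z0) x 0 \<and>
        (\<exists>c d w. 0 \<le> c \<and> c < d \<and> d \<le> 1 \<and> x \<in> {c, d} \<and>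
           has_weak_deriv c d (\<lambda>y. \<mu> * weak_deriv u0 y) w \<and>
           has_boundary_value c d (\<lambda>y. a * (1 / v0 y) * \<theta>0 y - w y) x 0))"

definition initial_data ::
  "real \<Rightarrow> real \<Rightarrow> real \<Rightarrow> real \<Rightarrow>
   (real \<Rightarrow> real) \<Rightarrow> (real \<Rightarrow> real) \<Rightarrow> (real \<Rightarrow> real) \<Rightarrow> (real \<Rightarrow> real) \<Rightarrow> bool" where
  "initial_data a \<mu> m0 M0 v0 u0 \<theta>0 Z0 \<longleftrightarrow>
     (AE y\<in>{0..1} in lborel.
        m0 \<le> 1 / v0 y \<and> 1 / v0 y \<le> M0 \<and> m0 \<le> \<theta>0 y \<and> \<theta>0 y \<le> M0 \<and> 0 \<le> Z0 y \<and> Z0 y \<le> 1) \<and>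
     compatible_data a \<mu> v0 u0 \<theta>0 Z0 \<and>
     (LINT y:{0..1}|lborel. v0 y) = 1"

definition data_norm ::
  "(real \<Rightarrow> real) \<Rightarrow> (real \<Rightarrow> real) \<Rightarrow> (real \<Rightarrow> real) \<Rightarrow> (real \<Rightarrow> real) \<Rightarrow> real" where
  "data_norm v0 u0 \<theta>0 Z0 =
     Hk_norm 1 v0 + W1inf_norm v0 + Hk_norm 1 u0 + Hk_norm 1 \<theta>0 + Hk_norm 1 Z0"

text \<open>Here \<open>0 * ln 0 = 0\<close> holds by the library convention for multiplication by zero.\<close>

definition Ent :: "(real \<Rightarrow> real) \<Rightarrow> real" where
  "Ent f = (LINT y:{0..1}|lborel. f y * ln (f y)) -
     (LINT y:{0..1}|lborel. f y) * ln (LINT y:{0..1}|lborel. f y)"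

end

theory Submission
  imports Defs
begin

text \<open>
  The bound comes from the \<open>L\<^sup>2\<close> energy of \<open>Z\<close> alone. As \<open>\<bar>x ln x\<bar> \<le> x\<^sup>2 + 1\<close>, the entropy is at
  most \<open>2 \<integral> Z\<^sup>2 + 2\<close>. Testing the equation for \<open>Z\<close> with \<open>Z\<close> itself, where \<open>\<phi> \<ge> 0\<close> and the flux
  \<open>D Z\<^sub>y / v\<^sup>2\<close> vanishes on \<open>\<partial>\<Omega>\<close>, gives
  \<open>\<integral> Z(t)\<^sup>2 \<le> \<integral> Z(s)\<^sup>2\<close> for almost all \<open>s \<le> t\<close>. The continuity of \<open>t \<mapsto> Z(t)\<close> in \<open>L\<^sup>2\<close>
  and \<open>0 \<le> Z\<^sub>0 \<le> 1\<close> bound the energy at every time. The integrations by parts rest on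
  du Bois-Reymond's lemma: a function with weak derivative \<open>g\<close> is a.e. a constant plus a primitive
  of \<open>g\<close>. The null set in \<open>has_dt\<close> depends on the test function, so for derivatives in time that
  lemma is needed with only countably many test functions.
\<close>

section \<open>Smooth functions and bumps\<close>

text \<open>The obstacles lie in null sets rather than in estimates. The system and the regularity
  class each bring their own time derivative of \<open>Z\<close>: the first solves the equation, the
  second is square integrable, and uniqueness of weak derivatives merges them. On almost every line
  of constant y, \<open>Z\<close> is a.e. a primitive in time, with a constant whose dependence on y
  is not known to be measurable. Squaring on each line, rewriting the constant as a time average and
  applying Fubini turns these identities into one for the energy. The diffusive flux has a
  continuous representative since it has a weak derivative; it vanishes on the boundary because
  \<open>1 / v\<close> is bounded at almost every time. Monotonicity holds only for almost all pairs
  of times, so the times 0 and t are reached by continuity. Each passage turns a bound E into 2E +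
  2: 1 becomes 4, then 10, and the entropy bound is 2 * 10 + 2 = 22. A maximum principle for
  \<open>Z\<close> is avoided, as the entropy estimate accepts functions of either sign.\<close>

primrec times_differentiable :: "nat \<Rightarrow> (real \<Rightarrow> real) \<Rightarrow> bool" where
  "times_differentiable 0 f \<longleftrightarrow> True"
| "times_differentiable (Suc n) f \<longleftrightarrow>
     (\<exists>f'. (\<forall>x. (f has_real_derivative f' x) (at x)) \<and> times_differentiable n f')"

abbreviation smooth :: "(real \<Rightarrow> real) \<Rightarrow> bool" where
  "smooth f \<equiv> \<forall>n. times_differentiable n f"

lemma times_differentiable_Suc_D: "times_differentiable (Suc n) f \<Longrightarrow> times_differentiable n f"
  by (induction n arbitrary: f) (simp, (subst (asm) times_differentiable.simps(2), subst times_differentiable.simps(2), blast))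

lemma times_differentiable_add:
  "times_differentiable n f \<Longrightarrow> times_differentiable n g \<Longrightarrow> times_differentiable n (\<lambda>x. f x + g x)"
proof (induction n arbitrary: f g)
  case (Suc n)
  from Suc.prems obtain f' g' where "\<forall>x. (f has_real_derivative f' x) (at x)" "times_differentiable n f'"
    "\<forall>x. (g has_real_derivative g' x) (at x)" "times_differentiable n g'" by auto
  with Suc.IH[of f' g'] show ?case
    by (auto intro!: exI[of _ "\<lambda>x. f' x + g' x"] derivative_intros)
qed simp

lemma times_differentiable_mult:
  "times_differentiable n f \<Longrightarrow> times_differentiable n g \<Longrightarrow> times_differentiable n (\<lambda>x. f x * g x)"
proof (induction n arbitrary: f g)
  case (Suc n)
  from Suc.prems obtain f' g' where d: "\<forall>x. (f has_real_derivative f' x) (at x)" "times_differentiable n f'"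
    "\<forall>x. (g has_real_derivative g' x) (at x)" "times_differentiable n g'" by auto
  have "times_differentiable n (\<lambda>x. f' x * g x + g' x * f x)"
    using times_differentiable_Suc_D[OF Suc.prems(1)] times_differentiable_Suc_D[OF Suc.prems(2)] d
    by (simp add: times_differentiable_add Suc.IH)
  with d show ?case
    by (auto intro!: exI[of _ "\<lambda>x. f' x * g x + g' x * f x"] DERIV_mult)
qed simp

text \<open>One closure rule for scaling, shifting and reflecting. \<open>a\<close> and
  \<open>d\<close> stay arbitrary in the induction because the chain rule turns them into
  \<open>a * b\<close> and 0. Later definitions such as \<open>1 * F (1 * x + 0) + c\<close> are
  spelt out to match it.\<close>

lemma times_differentiable_affine:
  "times_differentiable n f \<Longrightarrow> times_differentiable n (\<lambda>x. a * f (b * x + c) + d)"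
proof (induction n arbitrary: f a d)
  case (Suc n)
  from Suc.prems obtain f' where d: "\<forall>x. (f has_real_derivative f' x) (at x)" "times_differentiable n f'" by auto
  have "((\<lambda>x. a * f (b * x + c) + d) has_real_derivative (a * b) * f' (b * x + c) + 0) (at x)" for x
    using d(1) by (auto intro!: derivative_eq_intros DERIV_chain'[where f="\<lambda>x. b * x + c" and g=f])
  with Suc.IH[OF d(2), of "a * b" 0] show ?case
    unfolding times_differentiable.simps by (intro exI[of _ "\<lambda>x. (a * b) * f' (b * x + c) + 0"]) auto
qed simp

lemma smooth_antiderivative:
  assumes "\<And>x. (F has_real_derivative f x) (at x)" "smooth f"
  shows "smooth F"
proof
  fix n show "times_differentiable n F" using assms by (cases n) auto
qed

lemma smooth_has_derivative:
  assumes "smooth f" shows "(f has_real_derivative deriv f x) (at x)"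
proof -
  have "times_differentiable (Suc 0) f" using assms by blast
  then obtain f' where "\<forall>x. (f has_real_derivative f' x) (at x)" by auto
  then show ?thesis using DERIV_imp_deriv by metis
qed

lemma smooth_deriv: assumes "smooth f" shows "smooth (deriv f)"
proof
  fix n
  obtain f' where f': "\<forall>x. (f has_real_derivative f' x) (at x)" "times_differentiable n f'"
    using assms[rule_format, of "Suc n"] by auto
  then have "f' = deriv f" by (metis DERIV_imp_deriv ext)
  then show "times_differentiable n (deriv f)" using f' by simp
qed

lemma smooth_continuous: "smooth f \<Longrightarrow> continuous_on S f"
  using DERIV_isCont[OF smooth_has_derivative] by (simp add: continuous_at_imp_continuous_on)

text \<open>Sums and products are hard to treat through the iterated \<open>deriv\<close> of
  \<open>test_function\<close>, whose values must be computed first. Recursion with a derivative as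
  witness gives the closure rules, and this equivalence carries them over.\<close>

lemma smooth_iff: "smooth f \<longleftrightarrow> (\<forall>n. (deriv ^^ n) f differentiable_on UNIV)"
proof
  assume "smooth f"
  then have "smooth ((deriv ^^ n) f)" for n by (induction n) (auto simp: smooth_deriv)
  then show "\<forall>n. (deriv ^^ n) f differentiable_on UNIV"
    using smooth_has_derivative differentiable_at_withinI real_differentiable_def
    unfolding differentiable_on_def by metis
next
  assume *: "\<forall>n. (deriv ^^ n) f differentiable_on UNIV"
  show "smooth f"
  proof
    fix n show "times_differentiable n f" using *
    proof (induction n arbitrary: f)
      case (Suc n)
      have "f differentiable_on UNIV" using Suc.prems[rule_format, of 0] by simp
      then have "\<forall>x. (f has_real_derivative deriv f x) (at x)"
        by (simp add: DERIV_deriv_iff_real_differentiable differentiable_on_def)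
      moreover have "times_differentiable n (deriv f)"
      proof (rule Suc.IH, rule)
        fix k show "(deriv ^^ k) (deriv f) differentiable_on UNIV"
          using Suc.prems[rule_format, of "Suc k"] by (simp add: funpow_Suc_right del: funpow.simps)
      qed
      ultimately show ?case by auto
    qed simp
  qed
qed

text \<open>Derivatives of \<open>exp (- 1 / x)\<close>, extended by \<open>0\<close>, stay in the family indexed by \<open>p\<close>.\<close>

definition flat_exp :: "real poly \<Rightarrow> real \<Rightarrow> real" where
  "flat_exp p x = (if 0 < x then poly p (1 / x) * exp (- (1 / x)) else 0)"

text \<open>With s = 1/x the right-hand limit becomes that of \<open>poly p s * exp (- s)\<close> at
  infinity, where the exponential beats each monomial; on the left the function is 0.\<close>

lemma flat_exp_tendsto: "(flat_exp p \<longlongrightarrow> 0) (at 0)"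
proof -
  have "((\<lambda>x. \<Sum>i\<le>degree p. coeff p i * (x ^ i / exp x)) \<longlongrightarrow> (\<Sum>i\<le>degree p. coeff p i * 0)) at_top"
    by (intro tendsto_sum tendsto_mult tendsto_const tendsto_power_div_exp_0)
  then have "((\<lambda>x. poly p x * exp (- x)) \<longlongrightarrow> 0) at_top"
    by (simp add: poly_altdef sum_distrib_right sum_divide_distrib exp_minus divide_inverse mult.assoc)
  then have "((\<lambda>x. poly p (1 / x) * exp (- (1 / x))) \<longlongrightarrow> 0) (at_right 0)"
    using filterlim_compose[OF _ filterlim_inverse_at_top_right] by (fastforce simp: inverse_eq_divide)
  then have "(flat_exp p \<longlongrightarrow> 0) (at_right 0)"
    by (rule Lim_transform_eventually)
      (auto simp: flat_exp_def eventually_at_filter)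
  moreover have "(flat_exp p \<longlongrightarrow> 0) (at_left 0)"
    by (rule Lim_transform_eventually[OF tendsto_const])
      (auto simp: flat_exp_def eventually_at_filter)
  ultimately show ?thesis by (simp add: filterlim_split_at)
qed

text \<open>In terms of s = 1/x, where ds/dx = - s^2, the derivative of p(s) exp(-s) is s^2 (p -
  p')(s) exp(-s). The two applications of \<open>pCons 0\<close> are the factor s^2.\<close>

lemma flat_exp_has_derivative:
  "(flat_exp p has_real_derivative flat_exp (pCons 0 (pCons 0 (p - pderiv p))) x) (at x)"
proof -
  consider "x > 0" | "x < 0" | "x = 0" by linarith
  then show ?thesis
  proof cases
    case 1
    have "((\<lambda>x. poly p (1 / x) * exp (- (1 / x))) has_real_derivative
        flat_exp (pCons 0 (pCons 0 (p - pderiv p))) x) (at x)"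
      using 1 by (auto intro!: derivative_eq_intros DERIV_chain'[OF _ poly_DERIV]
          simp: flat_exp_def field_simps power2_eq_square)
    then show ?thesis
      by (rule has_field_derivative_transform_within[of _ _ _ _ x])
        (use 1 in \<open>auto simp: flat_exp_def dist_real_def\<close>)
  next
    case 2
    have "((\<lambda>x. 0) has_real_derivative flat_exp (pCons 0 (pCons 0 (p - pderiv p))) x) (at x)"
      using 2 by (simp add: flat_exp_def)
    then show ?thesis
      by (rule has_field_derivative_transform_within[of _ _ _ _ "-x"])
        (use 2 in \<open>auto simp: flat_exp_def dist_real_def\<close>)
  next
    case 3
    \<comment> \<open>Dividing by y multiplies the polynomial by s = 1/y, so the difference quotient
      at 0 is again in the family and its limit is already known.\<close>
    have "(flat_exp p y - flat_exp p 0) / (y - 0) = flat_exp (pCons 0 p) y" for y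
      by (simp add: flat_exp_def)
    then show ?thesis
      using flat_exp_tendsto[of "pCons 0 p"] 3 unfolding has_field_derivative_iff
      by (simp add: flat_exp_def[of _ 0])
  qed
qed

lemma smooth_flat_exp: "smooth (flat_exp p)"
proof
  fix n show "times_differentiable n (flat_exp p)"
    by (induction n arbitrary: p) (auto intro: flat_exp_has_derivative)
qed

section \<open>Smooth primitives and a smooth step function\<close>

lemma smooth_antiderivative_ex:
  assumes "smooth f"
  obtains F where "\<And>x. (F has_real_derivative f x) (at x)" "smooth F"
proof -
  have "isCont f x" for x using smooth_has_derivative[OF assms] DERIV_isCont by blast
  then obtain F where F: "\<forall>x. (F has_vector_derivative f x) (at x)"
    using einterval_antiderivative[of "-\<infinity>" "\<infinity>" f] by auto
  then have "(F has_real_derivative f x) (at x)" for x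
    by (simp add: has_real_derivative_iff_has_vector_derivative)
  then show thesis using that smooth_antiderivative[OF _ assms] by blast
qed

lemma DERIV_zero_eq:
  fixes F :: "real \<Rightarrow> real"
  assumes "\<And>x. (F has_real_derivative f x) (at x)" "\<And>x. x \<in> {a..b} \<Longrightarrow> f x = 0" "a \<le> b"
  shows "F a = F b"
proof (cases "a < b")
  case True
  have "continuous_on {a..b} F"
    using DERIV_isCont[OF assms(1)] by (simp add: continuous_at_imp_continuous_on)
  moreover have "(F has_real_derivative 0) (at x)" if "a < x" "x < b" for x
    using assms(1)[of x] assms(2)[of x] that by simp
  ultimately show ?thesis
    using DERIV_isconst_end[OF True, of F] by simp
qed (use assms in auto)

text \<open>The step is the primitive of a bump supported in [0,1], normalised to run from 0 to
  1.\<close>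

lemma smooth_step_ex:
  obtains \<sigma> :: "real \<Rightarrow> real" where "smooth \<sigma>" "\<And>x. x \<le> 0 \<Longrightarrow> \<sigma> x = 0" "\<And>x. 1 \<le> x \<Longrightarrow> \<sigma> x = 1"
    "\<And>x. 0 \<le> \<sigma> x" "\<And>x. \<sigma> x \<le> 1"
proof -
  define \<beta> where "\<beta> x = flat_exp 1 x * flat_exp 1 (1 - x)" for x
  have "smooth (\<lambda>x. flat_exp 1 (1 - x))"
    using times_differentiable_affine[OF smooth_flat_exp[rule_format], where a=1 and b="-1" and c=1 and d=0]
    by simp
  then have "smooth \<beta>" unfolding \<beta>_def using smooth_flat_exp times_differentiable_mult by blast
  then obtain F where F: "\<And>x. (F has_real_derivative \<beta> x) (at x)" "smooth F"
    using smooth_antiderivative_ex by blast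
  have pos: "\<beta> x > 0" if "0 < x" "x < 1" for x using that by (simp add: \<beta>_def flat_exp_def)
  have zero: "\<beta> x = 0" if "x \<le> 0 \<or> 1 \<le> x" for x using that by (auto simp: \<beta>_def flat_exp_def)
  have nn: "\<beta> x \<ge> 0" for x by (simp add: \<beta>_def flat_exp_def)
  have mono: "F x \<le> F y" if "x \<le> y" for x y
    by (rule DERIV_nonneg_imp_nondecreasing[where f=F, OF that]) (use F(1) nn in blast)
  \<comment> \<open>The bump vanishes at 0 and 1, so strict growth is taken on a closed interval
    inside; it makes the normalising factor F 1 - F 0 positive.\<close>
  have "F (1/3) < F (2/3)"
  proof (rule DERIV_pos_imp_increasing[where f=F])
    fix x :: real assume "1/3 \<le> x" "x \<le> 2/3"
    then have "\<beta> x > 0" by (intro pos) linarith+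
    with F(1) show "\<exists>y. (F has_real_derivative y) (at x) \<and> 0 < y" by blast
  qed simp
  then have lt: "F 0 < F 1" using mono[of 0 "1/3"] mono[of "2/3" 1] by simp
  have F0: "F x = F 0" if "x \<le> 0" for x
    by (rule DERIV_zero_eq[OF F(1)]) (use that zero in auto)
  have F1: "F x = F 1" if "1 \<le> x" for x
    by (rule DERIV_zero_eq[OF F(1), symmetric]) (use that zero in auto)
  define \<sigma> where "\<sigma> x = (1 / (F 1 - F 0)) * F (1 * x + 0) + (- F 0 / (F 1 - F 0))" for x
  have \<sigma>: "\<sigma> x = (F x - F 0) / (F 1 - F 0)" for x by (simp add: \<sigma>_def diff_divide_distrib)
  have "smooth \<sigma>" unfolding \<sigma>_def[abs_def] using F(2) by (intro allI times_differentiable_affine) simp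
  have b: "F 0 \<le> F x" "F x \<le> F 1" for x
    using mono[of 0 x] mono[of x 1] F0[of x] F1[of x] lt by (cases "x \<le> 0"; cases "1 \<le> x"; simp)+
  have s0: "\<sigma> x = 0" if "x \<le> 0" for x using F0[OF that] by (simp add: \<sigma>)
  have s1: "\<sigma> x = 1" if "1 \<le> x" for x using F1[OF that] lt by (simp add: \<sigma>)
  have s2: "0 \<le> \<sigma> x" "\<sigma> x \<le> 1" for x using b[of x] lt by (simp_all add: \<sigma>)
  show thesis by (rule that[OF \<open>smooth \<sigma>\<close> s0 s1 s2])
qed

section \<open>Test functions: products with integrable functions and primitives\<close>

lemma test_function_iff:
  "test_function a b \<psi> \<longleftrightarrow> smooth \<psi> \<and> (\<exists>c d. a < c \<and> d < b \<and> (\<forall>x. x \<notin> {c..d} \<longrightarrow> \<psi> x = 0))"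
  unfolding test_function_def smooth_iff ..

lemma set_integrable_mult_continuous:
  fixes f g :: "real \<Rightarrow> real"
  assumes "set_integrable lborel {a..b} f" "continuous_on {a..b} g"
  shows "set_integrable lborel {a..b} (\<lambda>x. f x * g x)"
proof -
  obtain B where B: "\<And>x. x \<in> {a..b} \<Longrightarrow> norm (g x) \<le> B"
    using compact_imp_bounded[OF compact_continuous_image[OF assms(2) compact_Icc]]
    unfolding bounded_iff by blast
  have m: "(\<lambda>x. indicator {a..b} x * g x) \<in> borel_measurable lborel"
    using borel_measurable_continuous_on_indicator[OF _ assms(2)] by simp
  have "integrable lborel (\<lambda>x. (indicator {a..b} x * f x) * (indicator {a..b} x * g x))"
  proof (rule Bochner_Integration.integrable_bound)
    show "integrable lborel (\<lambda>x. \<bar>B\<bar> * (indicator {a..b} x * f x))"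
      using assms(1) by (simp add: set_integrable_def)
    show "AE x in lborel. norm ((indicator {a..b} x * f x) * (indicator {a..b} x * g x))
        \<le> norm (\<bar>B\<bar> * (indicator {a..b} x * f x))"
    proof (rule AE_I2)
      fix x
      show "norm ((indicator {a..b} x * f x) * (indicator {a..b} x * g x))
        \<le> norm (\<bar>B\<bar> * (indicator {a..b} x * f x))"
      proof (cases "x \<in> {a..b}")
        case True
        have "\<bar>f x\<bar> * \<bar>g x\<bar> \<le> \<bar>f x\<bar> * \<bar>B\<bar>" using B[OF True] by (intro mult_left_mono) auto
        then show ?thesis using True by (simp add: abs_mult mult.commute)
      qed simp
    qed
    have "(\<lambda>x. indicator {a..b} x * f x) \<in> borel_measurable lborel"
      using assms(1) borel_measurable_integrable by (fastforce simp: set_integrable_def)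
    then show "(\<lambda>x. (indicator {a..b} x * f x) * (indicator {a..b} x * g x)) \<in> borel_measurable lborel"
      using m by (rule borel_measurable_times)
  qed
  moreover have "(\<lambda>x. (indicator {a..b} x * f x) * (indicator {a..b} x * g x))
      = (\<lambda>x. indicator {a..b} x *\<^sub>R (f x * g x))"
    by (simp add: indicator_def fun_eq_iff)
  ultimately show ?thesis by (simp only: set_integrable_def)
qed

lemma test_function_continuous: "test_function a b \<psi> \<Longrightarrow> continuous_on S \<psi>"
  by (simp add: test_function_iff smooth_continuous)

text \<open>A primitive is constant on either side of the support. Zero mean makes the two constants
  equal, so subtracting that value restores compact support.\<close>

lemma test_function_antiderivative:
  assumes "test_function a b \<phi>" "a < b" "(LINT x:{a..b}|lborel. \<phi> x) = 0"
  obtains \<psi> where "test_function a b \<psi>" "deriv \<psi> = \<phi>"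
proof -
  obtain c d where cd: "a < c" "d < b" "\<And>x. x \<notin> {c..d} \<Longrightarrow> \<phi> x = 0" and sm: "smooth \<phi>"
    using assms(1) by (auto simp: test_function_iff)
  obtain F where F: "\<And>x. (F has_real_derivative \<phi> x) (at x)" "smooth F"
    using smooth_antiderivative_ex[OF sm] by blast
  have "(LINT x:{a..b}|lborel. \<phi> x) = F b - F a"
    using integral_FTC_Icc_real[of a b F \<phi>] assms(2) F(1) DERIV_isCont[OF smooth_has_derivative[OF sm]]
    by (simp add: set_lebesgue_integral_def mult.commute)
  with assms(3) have ab: "F b = F a" by simp
  \<comment> \<open>When c > d the support interval is empty and the function is 0; the midpoint of
    ]a,b[ then replaces both ends.\<close>
  define e where "e = (if c \<le> d then c else (a + b) / 2)"
  define e' where "e' = (if c \<le> d then d else (a + b) / 2)"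
  have e: "a < e" "e \<le> e'" "e' < b" "\<And>x. x < e \<or> e' < x \<Longrightarrow> \<phi> x = 0"
    using cd assms(2) by (auto simp: e_def e'_def split: if_splits)
  define \<psi> where "\<psi> x = 1 * F (1 * x + 0) + (- F a)" for x
  have \<psi>: "\<psi> x = F x - F a" for x by (simp add: \<psi>_def)
  obtain e1 where e1: "a < e1" "e1 < e" using dense[OF e(1)] by blast
  obtain e2 where e2: "e' < e2" "e2 < b" using dense[OF e(3)] by blast
  note e12 = e1 e2
  have L: "F x = F a" if "x < e1" for x
  proof (cases "x \<le> a")
    case True then show ?thesis using e12 by (intro DERIV_zero_eq[OF F(1)] e) auto
  next
    case False then show ?thesis using e12 that by (intro DERIV_zero_eq[OF F(1), symmetric] e) auto
  qed
  have R: "F x = F b" if "x > e2" for x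
  proof (cases "x \<le> b")
    case True then show ?thesis using e12 that by (intro DERIV_zero_eq[OF F(1)] e) auto
  next
    case False then show ?thesis using e12 by (intro DERIV_zero_eq[OF F(1), symmetric] e) auto
  qed
  have "smooth \<psi>" unfolding \<psi>_def[abs_def] using F(2) by (intro allI times_differentiable_affine) simp
  moreover have "\<psi> x = 0" if "x \<notin> {e1..e2}" for x
    using that L[of x] R[of x] ab by (cases "x < e1") (simp_all add: \<psi>)
  ultimately have "test_function a b \<psi>"
    unfolding test_function_iff using e12 by blast
  moreover have "deriv \<psi> = \<phi>"
    unfolding \<psi>_def[abs_def]
    by (rule ext, rule DERIV_imp_deriv) (auto intro!: derivative_eq_intros F(1))
  ultimately show thesis using that by blast
qed

section \<open>Countably many test functions\<close>

text \<open>Half-lines form an intersection-stable generator of the Borel sets, so by the pi-lambda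
  principle \<open>h\<close> has integral 0 over every Borel set.\<close>

lemma AE_eq_0_if_integrals_atMost:
  fixes h :: "real \<Rightarrow> real"
  assumes h: "integrable lborel h" and zero: "\<And>t. (LINT x:{..t}|lborel. h x) = 0"
  shows "AE x in lborel. h x = 0"
proof (rule sigma_finite_measure.density_zero[OF lborel.sigma_finite_measure_axioms h])
  have si: "set_integrable lborel A h" if "A \<in> sets lborel" for A
    using integrable_mult_indicator[OF that h] by (simp add: set_integrable_def)
  \<comment> \<open>The integral over the whole line is needed for complements, and is the limit of
    the integrals over half-lines.\<close>
  have "((\<lambda>t. LINT x:{..t}|lborel. h x) \<longlongrightarrow> (LINT x|lborel. h x)) at_top"
    unfolding set_lebesgue_integral_def using h by (intro tendsto_integral_at_top) auto
  then have all: "(LINT x|lborel. h x) = 0"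
    by (simp add: zero tendsto_const_iff)
  fix A :: "real set" assume "A \<in> sets lborel"
  then have "A \<in> sigma_sets UNIV (range atMost)"
    by (simp add: borel_eq_atMost)
  then have "Int_stable (range atMost :: real set set)"
    "range atMost \<subseteq> Pow (UNIV :: real set)" "A \<in> sigma_sets UNIV (range atMost)"
    by (auto simp: Int_stable_def)
  then show "(LINT x:A|lborel. h x) = 0"
  proof (induction rule: sigma_sets_induct_disjoint)
    case (basic A) then show ?case using zero by auto
  next
    case empty show ?case by (simp add: set_lebesgue_integral_def)
  next
    case (compl A)
    then have A: "A \<in> sets lborel" by (simp add: borel_eq_atMost)
    then have "(LINT x:A \<union> (UNIV - A)|lborel. h x) = (LINT x:A|lborel. h x) + (LINT x:UNIV - A|lborel. h x)"
      by (intro set_integral_Un si) auto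
    then show ?case using all compl by (simp add: set_lebesgue_integral_def)
  next
    case (union A)
    then have A: "A i \<in> sets lborel" for i by (auto simp: borel_eq_atMost)
    have "(LINT x:(\<Union>i. A i)|lborel. h x) = (\<Sum>i. LINT x:A i|lborel. h x)"
      using union A by (intro lebesgue_integral_countable_add si)
        (auto simp: disjoint_family_on_def)
    then show ?case using union by simp
  qed
qed

text \<open>Smoothed indicators with rational parameters suffice: they converge boundedly to
  indicators of ]a,t[, so orthogonality passes to the limit by dominated convergence and settles all
  half-lines.\<close>

lemma ex_countable_test_functions:
  fixes a b :: real
  assumes "a < b"
  obtains \<Phi> where "countable \<Phi>" "\<And>\<phi>. \<phi> \<in> \<Phi> \<Longrightarrow> test_function a b \<phi>"
    "\<And>h. set_integrable lborel {a..b} h \<Longrightarrow> (\<And>\<phi>. \<phi> \<in> \<Phi> \<Longrightarrow> (LINT x:{a..b}|lborel. h x * \<phi> x) = 0)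
       \<Longrightarrow> AE x\<in>{a..b} in lborel. h x = 0"
proof -
  obtain \<sigma> :: "real \<Rightarrow> real" where \<sigma>: "smooth \<sigma>" "\<And>x. x \<le> 0 \<Longrightarrow> \<sigma> x = 0" "\<And>x. 1 \<le> x \<Longrightarrow> \<sigma> x = 1"
    "\<And>x. 0 \<le> \<sigma> x" "\<And>x. \<sigma> x \<le> 1"
    using smooth_step_ex by blast
  \<comment> \<open>A smoothed indicator of an interval: the first step climbs on [s, s + 1/k], and
    the second cancels it on [t, t + 1/k].\<close>
  define \<phi> :: "real \<times> real \<times> nat \<Rightarrow> real \<Rightarrow> real"
    where "\<phi> = (\<lambda>(s, t, k) x. \<sigma> (real k * (x - s)) - \<sigma> (real k * (x - t)))"
  have \<phi>_test: "test_function a b (\<phi> (s, t, k))"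
    if "a < s" "s < t" "t + 1 / real k < b" "0 < k" for s t k
  proof -
    have "smooth (\<lambda>x. (1 * \<sigma> (real k * x + (- real k * s)) + 0) + (-1 * \<sigma> (real k * x + (- real k * t)) + 0))"
      using \<sigma>(1) by (intro allI times_differentiable_add times_differentiable_affine) simp_all
    then have "smooth (\<phi> (s, t, k))"
      by (simp add: \<phi>_def algebra_simps)
    moreover have "\<phi> (s, t, k) x = 0" if x: "x \<notin> {s..t + 1 / real k}" for x
    proof (cases "x < s")
      case True
      then show ?thesis using \<open>s < t\<close> \<open>0 < k\<close> by (simp add: \<phi>_def \<sigma>(2) mult_le_0_iff)
    next
      case False
      with x have *: "x > t + 1 / real k" by auto
      with \<open>0 < k\<close> have "real k * (x - t) \<ge> 1" by (simp add: field_simps)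
      moreover have "real k * (x - s) \<ge> real k * (x - t)" using \<open>s < t\<close> by (intro mult_left_mono) auto
      ultimately show ?thesis by (simp add: \<phi>_def \<sigma>(3))
    qed
    ultimately show ?thesis unfolding test_function_iff using that by blast
  qed
  define I where "I = {(s, t, k). s \<in> \<rat> \<and> t \<in> \<rat> \<and> test_function a b (\<phi> (s, t, k))}"
  have "countable (\<rat> \<times> \<rat> \<times> (UNIV :: nat set) :: (real \<times> real \<times> nat) set)"
    by (intro countable_SIGMA countable_rat) auto
  then have "countable I" by (rule countable_subset[rotated]) (auto simp: I_def)
  then have "countable (\<phi> ` I)" by simp
  moreover have "test_function a b \<psi>" if "\<psi> \<in> \<phi> ` I" for \<psi>
    using that by (auto simp: I_def)
  moreover have "AE x\<in>{a..b} in lborel. h x = 0"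
    if h: "set_integrable lborel {a..b} h"
      and orth: "\<And>\<psi>. \<psi> \<in> \<phi> ` I \<Longrightarrow> (LINT x:{a..b}|lborel. h x * \<psi> x) = 0" for h
  proof -
    define g where "g x = indicator {a..b} x * h x" for x
    have g: "integrable lborel g" using h by (simp add: set_integrable_def g_def[abs_def])
    have mid: "(LINT x|lborel. indicator {a<..<t} x * g x) = 0" if t: "a < t" "t \<le> b" for t
    proof -
      \<comment> \<open>Four lengths \<open>\<delta> n\<close> fit into ]a,t[. Hence s < a +
        \<delta> and t - 2\<delta> < r < t - \<delta> give s < r, and 1/k < \<delta> ends the
        descent before t, hence before b.\<close>
      define \<delta> where "\<delta> n = (t - a) / 4 * inverse (real (Suc n))" for n
      have \<delta>: "\<delta> n > 0" "4 * \<delta> n \<le> t - a" for n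
        using t mult_left_le[of "inverse (real (Suc n))" "t - a"] by (auto simp: \<delta>_def inverse_le_1_iff)
      have \<delta>0: "\<delta> \<longlonglongrightarrow> 0" unfolding \<delta>_def[abs_def]
        by (rule tendsto_mult_right_zero[OF LIMSEQ_inverse_real_of_nat])
      have "\<exists>s\<in>\<rat>. a < s \<and> s < a + \<delta> n" for n using Rats_dense_in_real[of a "a + \<delta> n"] \<delta> by auto
      then obtain s where s: "\<And>n. s n \<in> \<rat>" "\<And>n. a < s n" "\<And>n. s n < a + \<delta> n" by metis
      have "\<exists>r\<in>\<rat>. t - 2 * \<delta> n < r \<and> r < t - \<delta> n" for n
        using Rats_dense_in_real[of "t - 2 * \<delta> n" "t - \<delta> n"] \<delta> by auto
      then obtain r where r: "\<And>n. r n \<in> \<rat>" "\<And>n. t - 2 * \<delta> n < r n" "\<And>n. r n < t - \<delta> n" by metis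
      have "\<exists>k::nat. real k > 1 / \<delta> n" for n using reals_Archimedean2 by blast
      then obtain k where k: "\<And>n. real (k n) > 1 / \<delta> n" by metis
      have k1: "k n > 0" "1 / real (k n) < \<delta> n" "real (k n) * \<delta> n \<ge> 1" for n
      proof -
        have pos: "real (k n) > 0" by (rule less_trans[OF _ k]) (simp add: \<delta>(1))
        then show "k n > 0" by simp
        show "1 / real (k n) < \<delta> n" "real (k n) * \<delta> n \<ge> 1"
          using pos k[of n] \<delta>(1)[of n] by (simp_all add: field_simps)
      qed
      have "(s n, r n, k n) \<in> I" for n
        unfolding I_def using s(1)[of n] r(1)[of n]
        by (auto intro!: \<phi>_test) (use s[of n] r[of n] k1[of n] \<delta>[of n] t in linarith)+
      then have "(LINT x:{a..b}|lborel. h x * \<phi> (s n, r n, k n) x) = 0" for n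
        by (intro orth) auto
      then have z: "(LINT x|lborel. g x * \<phi> (s n, r n, k n) x) = 0" for n
        by (simp add: set_lebesgue_integral_def g_def mult.assoc)
      have "(\<lambda>n. LINT x|lborel. g x * \<phi> (s n, r n, k n) x) \<longlonglongrightarrow> (LINT x|lborel. indicator {a<..<t} x * g x)"
      proof (rule integral_dominated_convergence[where w="\<lambda>x. \<bar>g x\<bar>"])
        show "(\<lambda>x. indicator {a<..<t} x * g x) \<in> borel_measurable lborel"
          using g by (intro borel_measurable_times) auto
        show "(\<lambda>x. g x * \<phi> (s n, r n, k n) x) \<in> borel_measurable lborel" for n
        proof -
          have "continuous_on UNIV \<sigma>" using smooth_continuous[OF \<sigma>(1)] .
          then have [measurable]: "\<sigma> \<in> borel_measurable borel" by (rule borel_measurable_continuous_onI)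
          have "\<phi> (s n, r n, k n) \<in> borel_measurable lborel" unfolding \<phi>_def by simp
          then show ?thesis using g by (intro borel_measurable_times) auto
        qed
        show "integrable lborel (\<lambda>x. \<bar>g x\<bar>)" using g by simp
        have "\<bar>\<phi> i x\<bar> \<le> 1" for i x
          using \<sigma>(4,5)[of "real (snd (snd i)) * (x - fst i)"] \<sigma>(4,5)[of "real (snd (snd i)) * (x - fst (snd i))"]
          by (simp add: \<phi>_def case_prod_beta)
        then have "\<bar>g x\<bar> * \<bar>\<phi> i x\<bar> \<le> \<bar>g x\<bar> * 1" for i x by (intro mult_left_mono) auto
        then show "AE x in lborel. norm (g x * \<phi> (s n, r n, k n) x) \<le> \<bar>g x\<bar>" for n
          by (simp add: abs_mult)
        have "(\<lambda>n. g x * \<phi> (s n, r n, k n) x) \<longlonglongrightarrow> indicator {a<..<t} x * g x" if x: "x \<noteq> t" for x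
        proof -
          consider "x \<le> a" | "a < x" "x < t" | "x > t" using x by linarith
          then show ?thesis
          proof cases
            case 1
            have "\<phi> (s n, r n, k n) x = 0" for n
            proof -
              have "x \<le> s n" using s(2)[of n] 1 by linarith
              moreover have "x \<le> r n" using r(2)[of n] \<delta>[of n] 1 by linarith
              ultimately show ?thesis by (simp add: \<phi>_def \<sigma>(2) mult_le_0_iff)
            qed
            then show ?thesis using 1 by simp
          next
            case 2
            \<comment> \<open>Once 2\<delta> is below the distance from x to both a and t, x lies
              past the ascent from s and still before r, so the smoothed indicator is exactly 1
              there.\<close>
            have "\<forall>\<^sub>F n in sequentially. \<delta> n < min ((x - a) / 2) ((t - x) / 2)"
              using 2 by (intro order_tendstoD[OF \<delta>0]) auto
            then have "\<forall>\<^sub>F n in sequentially. indicator {a<..<t} x * g x = g x * \<phi> (s n, r n, k n) x"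
            proof eventually_elim
              case (elim n)
              then have lt: "2 * \<delta> n < x - a" "2 * \<delta> n < t - x" by simp_all
              then have "x \<le> r n" using r(2)[of n] by linarith
              moreover have "x - s n \<ge> \<delta> n" using lt \<delta>[of n] s(3)[of n] by linarith
              moreover from this have "real (k n) * (x - s n) \<ge> real (k n) * \<delta> n" by (intro mult_left_mono) auto
              moreover have "real (k n) * \<delta> n \<ge> 1" by (rule k1)
              ultimately show ?case using 2 by (simp add: \<phi>_def \<sigma>(2,3) mult_le_0_iff)
            qed
            then show ?thesis by (rule Lim_transform_eventually[OF tendsto_const])
          next
            case 3
            have "\<phi> (s n, r n, k n) x = 0" for n
            proof -
              have "\<delta> n \<le> x - s n" using s(3)[of n] \<delta>[of n] 3 by linarith
              moreover have "\<delta> n \<le> x - r n" using r(3)[of n] 3 by linarith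
              ultimately have "real (k n) * (x - s n) \<ge> real (k n) * \<delta> n"
                "real (k n) * (x - r n) \<ge> real (k n) * \<delta> n"
                by (auto intro!: mult_left_mono)
              moreover have "real (k n) * \<delta> n \<ge> 1" by (rule k1)
              ultimately show ?thesis by (simp add: \<phi>_def \<sigma>(3))
            qed
            then show ?thesis using 3 by simp
          qed
        qed
        then show "AE x in lborel. (\<lambda>n. g x * \<phi> (s n, r n, k n) x) \<longlonglongrightarrow> indicator {a<..<t} x * g x"
          using AE_lborel_singleton[of t] by (auto elim: eventually_mono)
      qed
      then show ?thesis by (simp add: z LIMSEQ_const_iff)
    qed
    have "(LINT x:{..t}|lborel. g x) = 0" for t
    proof -
      \<comment> \<open>As \<open>g\<close> vanishes off [a,b], a half-line meets its support in the
        interval from a to min t b, or in at most one point if t \<le> a. Endpoints are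
        null.\<close>
      have "AE x in lborel. indicator {..t} x *\<^sub>R g x = (if a < t then indicator {a<..<min t b} x * g x else 0)"
        using AE_lborel_singleton[of a] AE_lborel_singleton[of b] AE_lborel_singleton[of t]
        by eventually_elim (auto simp: g_def indicator_def)
      then have "(LINT x:{..t}|lborel. g x) = (LINT x|lborel. (if a < t then indicator {a<..<min t b} x * g x else 0))"
        unfolding set_lebesgue_integral_def using g by (intro integral_cong_AE) auto
      also have "\<dots> = 0" using mid[of "min t b"] assms by (cases "a < t") simp_all
      finally show ?thesis .
    qed
    then have "AE x in lborel. g x = 0" using g by (rule AE_eq_0_if_integrals_atMost[rotated])
    then show ?thesis by eventually_elim (auto simp: g_def)
  qed
  ultimately show thesis using that by blast
qed

text \<open>If every member of the separating family had integral 0, the constant 1 would be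
  orthogonal to the family and thus vanish a.e.; rescaling a member with nonzero integral does the
  rest.\<close>

lemma ex_unit_test_function:
  assumes "a < b"
  obtains \<eta> where "test_function a b \<eta>" "(LINT x:{a..b}|lborel. \<eta> x) = 1"
proof -
  obtain \<Phi> where "countable \<Phi>" and \<Phi>: "\<And>\<phi>. \<phi> \<in> \<Phi> \<Longrightarrow> test_function a b \<phi>"
    "\<And>h. set_integrable lborel {a..b} h \<Longrightarrow> (\<And>\<phi>. \<phi> \<in> \<Phi> \<Longrightarrow> (LINT x:{a..b}|lborel. h x * \<phi> x) = 0)
       \<Longrightarrow> AE x\<in>{a..b} in lborel. h x = 0"
    using ex_countable_test_functions[OF assms] by blast
  have "\<exists>\<phi>\<in>\<Phi>. (LINT x:{a..b}|lborel. \<phi> x) \<noteq> 0"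
  proof (rule ccontr)
    assume "\<not> ?thesis"
    then have "AE x\<in>{a..b} in lborel. (1::real) = 0"
      by (intro \<Phi>(2) borel_integrable_atLeastAtMost') auto
    then have "AE x in lborel. x \<notin> {a..b}" by simp
    then have "emeasure lborel {x \<in> space lborel. \<not> x \<notin> {a..b}} = 0"
      by (subst (asm) AE_iff_measurable[OF _ refl]) auto
    moreover have "{x \<in> space lborel. \<not> x \<notin> {a..b}} = {a..b}" by auto
    ultimately show False using assms by simp
  qed
  then obtain \<phi> where \<phi>: "test_function a b \<phi>" "(LINT x:{a..b}|lborel. \<phi> x) \<noteq> 0"
    using \<Phi>(1) by blast
  obtain c d where "a < c" "d < b" "\<forall>x. x \<notin> {c..d} \<longrightarrow> \<phi> x = 0" "smooth \<phi>"
    using \<phi>(1) by (auto simp: test_function_iff)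
  moreover have "smooth (\<lambda>x. (1 / (LINT x:{a..b}|lborel. \<phi> x)) * \<phi> (1 * x + 0) + 0)"
    using \<open>smooth \<phi>\<close> by (intro allI times_differentiable_affine) simp
  ultimately have "test_function a b (\<lambda>x. (1 / (LINT x:{a..b}|lborel. \<phi> x)) * \<phi> x)"
    unfolding test_function_iff by (intro conjI exI[of _ c] exI[of _ d] allI impI) simp_all
  moreover have "(LINT x:{a..b}|lborel. (1 / (LINT x:{a..b}|lborel. \<phi> x)) * \<phi> x) = 1"
    using \<phi>(2) by simp
  ultimately show thesis by (rule that)
qed

section \<open>The du Bois-Reymond lemma with countably many test functions\<close>

lemma test_function_diff:
  assumes "test_function a b \<phi>" "test_function a b \<eta>"
  shows "test_function a b (\<lambda>x. \<phi> x - c * \<eta> x)"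
proof -
  obtain c1 d1 where 1: "a < c1" "d1 < b" "\<forall>x. x \<notin> {c1..d1} \<longrightarrow> \<phi> x = 0" "smooth \<phi>"
    using assms(1) by (auto simp: test_function_iff)
  obtain c2 d2 where 2: "a < c2" "d2 < b" "\<forall>x. x \<notin> {c2..d2} \<longrightarrow> \<eta> x = 0" "smooth \<eta>"
    using assms(2) by (auto simp: test_function_iff)
  have "smooth (\<lambda>x. \<phi> x + ((- c) * \<eta> (1 * x + 0) + 0))"
    using 1 2 by (intro allI times_differentiable_add times_differentiable_affine) simp_all
  then have "smooth (\<lambda>x. \<phi> x - c * \<eta> x)" by simp
  moreover have "\<forall>x. x \<notin> {min c1 c2..max d1 d2} \<longrightarrow> \<phi> x - c * \<eta> x = 0"
    using 1(3) 2(3) by (simp add: min_le_iff_disj le_max_iff_disj)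
  moreover have "a < min c1 c2" "max d1 d2 < b" using 1 2 by auto
  ultimately show ?thesis unfolding test_function_iff by blast
qed

lemma set_integrable_test_function:
  "test_function a b \<phi> \<Longrightarrow> set_integrable lborel {a..b} \<phi>"
  by (auto intro!: borel_integrable_atLeastAtMost' test_function_continuous)

text \<open>Removing the mean of each separating \<open>\<phi>\<close> with a fixed unit test
  function \<open>\<eta>\<close> leaves the derivative of a test function. One such primitive per
  \<open>\<phi>\<close> keeps the family countable.\<close>

lemma ex_countable_test_functions_deriv:
  fixes a b :: real
  assumes ab: "a < b"
  obtains \<Psi> where "countable \<Psi>" "\<And>\<psi>. \<psi> \<in> \<Psi> \<Longrightarrow> test_function a b \<psi>"
    "\<And>h. set_integrable lborel {a..b} h \<Longrightarrow> (\<And>\<psi>. \<psi> \<in> \<Psi> \<Longrightarrow> (LINT x:{a..b}|lborel. h x * deriv \<psi> x) = 0)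
       \<Longrightarrow> \<exists>c. AE x\<in>{a..b} in lborel. h x = c"
proof -
  obtain \<Phi> where \<Phi>: "countable \<Phi>" "\<And>\<phi>. \<phi> \<in> \<Phi> \<Longrightarrow> test_function a b \<phi>"
    "\<And>h. set_integrable lborel {a..b} h \<Longrightarrow> (\<And>\<phi>. \<phi> \<in> \<Phi> \<Longrightarrow> (LINT x:{a..b}|lborel. h x * \<phi> x) = 0)
       \<Longrightarrow> AE x\<in>{a..b} in lborel. h x = 0"
    using ex_countable_test_functions[OF assms] by blast
  obtain \<eta> where \<eta>: "test_function a b \<eta>" "(LINT x:{a..b}|lborel. \<eta> x) = 1"
    using ex_unit_test_function[OF ab] by blast
  define \<kappa> where "\<kappa> \<phi> x = \<phi> x - (LINT x:{a..b}|lborel. \<phi> x) * \<eta> x" for \<phi> x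
  have "\<exists>\<psi>. test_function a b \<psi> \<and> deriv \<psi> = \<kappa> \<phi>" if "\<phi> \<in> \<Phi>" for \<phi>
  proof -
    have "(LINT x:{a..b}|lborel. \<kappa> \<phi> x) = 0"
      unfolding \<kappa>_def using \<Phi>(2)[OF that] \<eta>
      by (subst set_integral_diff(2)) (simp_all add: set_integrable_test_function)
    moreover have "test_function a b (\<kappa> \<phi>)"
      unfolding \<kappa>_def[abs_def] using \<Phi>(2)[OF that] \<eta>(1) by (rule test_function_diff)
    ultimately show ?thesis using test_function_antiderivative[OF _ ab] by metis
  qed
  then obtain P where P: "\<And>\<phi>. \<phi> \<in> \<Phi> \<Longrightarrow> test_function a b (P \<phi>)" "\<And>\<phi>. \<phi> \<in> \<Phi> \<Longrightarrow> deriv (P \<phi>) = \<kappa> \<phi>"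
    by metis
  have "\<exists>c. AE x\<in>{a..b} in lborel. h x = c"
    if h: "set_integrable lborel {a..b} h"
      and orth: "\<And>\<psi>. \<psi> \<in> P ` \<Phi> \<Longrightarrow> (LINT x:{a..b}|lborel. h x * deriv \<psi> x) = 0" for h
  proof -
    \<comment> \<open>The only candidate: if h is constant, its integral against the unit
      \<open>\<eta>\<close> is that constant. With this choice, h against
      \<open>\<kappa> \<phi>\<close> equals h - c against \<open>\<phi>\<close>.\<close>
    define c where "c = (LINT x:{a..b}|lborel. h x * \<eta> x)"
    have const: "set_integrable lborel {a..b} (\<lambda>x. c)" by (intro borel_integrable_atLeastAtMost') auto
    have "AE x\<in>{a..b} in lborel. h x - c = 0"
    proof (rule \<Phi>(3))
      show "set_integrable lborel {a..b} (\<lambda>x. h x - c)" using h const by (rule set_integral_diff(1))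
      fix \<phi> assume \<phi>: "\<phi> \<in> \<Phi>"
      note int = set_integrable_mult_continuous[OF h test_function_continuous[OF \<Phi>(2)[OF \<phi>]]]
        set_integrable_mult_continuous[OF h test_function_continuous[OF \<eta>(1)]]
      let ?J = "LINT x:{a..b}|lborel. \<phi> x"
      have "0 = (LINT x:{a..b}|lborel. h x * \<kappa> \<phi> x)" using orth[of "P \<phi>"] P \<phi> by simp
      also have "\<dots> = (LINT x:{a..b}|lborel. h x * \<phi> x - ?J * (h x * \<eta> x))"
        by (simp add: \<kappa>_def algebra_simps)
      also have "\<dots> = (LINT x:{a..b}|lborel. h x * \<phi> x) - ?J * c"
        unfolding c_def using int by (subst set_integral_diff(2)) auto
      also have "\<dots> = (LINT x:{a..b}|lborel. (h x - c) * \<phi> x)"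
        unfolding left_diff_distrib using int set_integrable_test_function[OF \<Phi>(2)[OF \<phi>]]
        by (subst set_integral_diff(2)) (auto simp: mult.commute)
      finally show "(LINT x:{a..b}|lborel. (h x - c) * \<phi> x) = 0" by simp
    qed
    then show ?thesis by auto
  qed
  then show thesis using \<Phi>(1) P(1) by (intro that[of "P ` \<Phi>"]) auto
qed

text \<open>Fubini on the square \<open>[a,b]\<^sup>2\<close>, split along the diagonal.\<close>

lemma set_integral_by_parts:
  fixes g h :: "real \<Rightarrow> real"
  assumes g: "set_integrable lborel {a..b} g" and h: "set_integrable lborel {a..b} h"
  shows "(LINT x:{a..b}|lborel. (A + (LINT s:{a..x}|lborel. g s)) * h x) +
      (LINT x:{a..b}|lborel. g x * (B + (LINT s:{a..x}|lborel. h s))) =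
    (A + (LINT s:{a..b}|lborel. g s)) * (B + (LINT s:{a..b}|lborel. h s)) - A * B"
    and "set_integrable lborel {a..b} (\<lambda>x. (A + (LINT s:{a..x}|lborel. g s)) * h x)"
proof -
  define G where "G x = indicator {a..b} x * g x" for x
  define H where "H x = indicator {a..b} x * h x" for x
  have G: "integrable lborel G" using g by (simp add: set_integrable_def G_def[abs_def])
  have H: "integrable lborel H" using h by (simp add: set_integrable_def H_def[abs_def])
  have [measurable]: "G \<in> borel_measurable borel" "H \<in> borel_measurable borel" using G H by auto
  have GH: "integrable (lborel \<Otimes>\<^sub>M lborel) (\<lambda>(x, y). G x * H y)"
  proof (rule lborel_pair.Fubini_integrable)
    show "integrable lborel (\<lambda>x. LINT y|lborel. norm (case (x, y) of (x, y) \<Rightarrow> G x * H y))"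
      using G by (simp add: abs_mult)
    show "AE x in lborel. integrable lborel (\<lambda>y. case (x, y) of (x, y) \<Rightarrow> G x * H y)"
      using H by simp
  qed measurable
  have GHr: "integrable (lborel \<Otimes>\<^sub>M lborel) (\<lambda>(x, y). if R x y then G x * H y else 0)"
    if [measurable]: "Measurable.pred (lborel \<Otimes>\<^sub>M lborel) (\<lambda>(x, y). R x y)" for R
    by (rule Bochner_Integration.integrable_bound[OF GH]) (auto simp: case_prod_beta)
  \<comment> \<open>The diagonal belongs to the first half only, so the two pieces add up to the
    full product. The strict second half differs from integration over \<open>{a..x}\<close> in one
    point.\<close>
  have m1: "Measurable.pred (lborel \<Otimes>\<^sub>M lborel) (\<lambda>(x::real, y::real). x \<le> y)"
    and m2: "Measurable.pred (lborel \<Otimes>\<^sub>M lborel) (\<lambda>(x::real, y::real). y < x)"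
    by measurable
  have inner: "(LINT x|lborel. (if x \<le> y then G x * H y else 0)) = indicator {a..b} y * ((LINT s:{a..y}|lborel. g s) * h y)" for y
  proof -
    have "(LINT x|lborel. (if x \<le> y then G x * H y else 0)) = (LINT x|lborel. indicator {a..b} y * h y * (indicator {a..y} x * g x))"
      by (intro Bochner_Integration.integral_cong) (auto simp: G_def H_def indicator_def)
    also have "\<dots> = indicator {a..b} y * h y * (LINT x|lborel. indicator {a..y} x * g x)"
      by (rule integral_mult_right_zero)
    finally show ?thesis by (simp add: set_lebesgue_integral_def)
  qed
  have inner': "(LINT y|lborel. (if y < x then G x * H y else 0)) = indicator {a..b} x * (g x * (LINT s:{a..x}|lborel. h s))" for x
  proof -
    have "(LINT y|lborel. (if y < x then G x * H y else 0)) = (LINT y|lborel. indicator {a..b} x * g x * (indicator {a..x} y * h y))"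
    proof (rule integral_cong_AE)
      show "AE y in lborel. (if y < x then G x * H y else 0) = indicator {a..b} x * g x * (indicator {a..x} y * h y)"
        using AE_lborel_singleton[of x] by eventually_elim (simp add: G_def H_def indicator_def)
      have "(\<lambda>y. indicator {a..b} x * g x * (indicator {a..x} y * h y)) = (\<lambda>y. G x * (if y \<le> x then H y else 0))"
        by (auto simp: G_def H_def indicator_def)
      then show "(\<lambda>y. indicator {a..b} x * g x * (indicator {a..x} y * h y)) \<in> borel_measurable lborel"
        by simp
    qed measurable
    then show ?thesis by (simp add: set_lebesgue_integral_def mult.assoc)
  qed
  have I1: "set_integrable lborel {a..b} (\<lambda>x. (LINT s:{a..x}|lborel. g s) * h x)"
    using lborel_pair.integrable_snd[OF GHr[OF m1]] by (simp add: inner set_integrable_def)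
  have I2: "set_integrable lborel {a..b} (\<lambda>x. g x * (LINT s:{a..x}|lborel. h s))"
    using lborel_pair.integrable_fst[OF GHr[OF m2]] by (simp add: inner' set_integrable_def)
  have "(LINT s:{a..b}|lborel. g s) * (LINT s:{a..b}|lborel. h s) = (LINT x|lborel. (LINT y|lborel. G x * H y))"
    by (simp add: set_lebesgue_integral_def G_def H_def)
  also have "\<dots> = integral\<^sup>L (lborel \<Otimes>\<^sub>M lborel) (\<lambda>(x, y). G x * H y)"
    by (rule lborel_pair.integral_fst[OF GH])
  also have "\<dots> = integral\<^sup>L (lborel \<Otimes>\<^sub>M lborel) (\<lambda>p. (case p of (x, y) \<Rightarrow> if x \<le> y then G x * H y else 0) +
      (case p of (x, y) \<Rightarrow> if y < x then G x * H y else 0))"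
    by (intro Bochner_Integration.integral_cong) auto
  also have "\<dots> = integral\<^sup>L (lborel \<Otimes>\<^sub>M lborel) (\<lambda>(x, y). if x \<le> y then G x * H y else 0) +
      integral\<^sup>L (lborel \<Otimes>\<^sub>M lborel) (\<lambda>(x, y). if y < x then G x * H y else 0)"
    by (rule Bochner_Integration.integral_add[OF GHr[OF m1] GHr[OF m2]])
  also have "\<dots> = (LINT x:{a..b}|lborel. (LINT s:{a..x}|lborel. g s) * h x) +
      (LINT x:{a..b}|lborel. g x * (LINT s:{a..x}|lborel. h s))"
    using lborel_pair.integral_snd[OF GHr[OF m1]] lborel_pair.integral_fst[OF GHr[OF m2]]
    by (simp add: inner inner' set_lebesgue_integral_def)
  finally have eq: "(LINT s:{a..b}|lborel. g s) * (LINT s:{a..b}|lborel. h s) = \<dots>" .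
  have "(LINT x:{a..b}|lborel. (A + (LINT s:{a..x}|lborel. g s)) * h x) =
      A * (LINT s:{a..b}|lborel. h s) + (LINT x:{a..b}|lborel. (LINT s:{a..x}|lborel. g s) * h x)"
    unfolding distrib_right using h I1 by (subst set_integral_add(2)) auto
  moreover have "(LINT x:{a..b}|lborel. g x * (B + (LINT s:{a..x}|lborel. h s))) =
      (LINT s:{a..b}|lborel. g s) * B + (LINT x:{a..b}|lborel. g x * (LINT s:{a..x}|lborel. h s))"
    unfolding distrib_left using g I2 by (subst set_integral_add(2)) auto
  ultimately show "(LINT x:{a..b}|lborel. (A + (LINT s:{a..x}|lborel. g s)) * h x) +
      (LINT x:{a..b}|lborel. g x * (B + (LINT s:{a..x}|lborel. h s))) =
    (A + (LINT s:{a..b}|lborel. g s)) * (B + (LINT s:{a..b}|lborel. h s)) - A * B"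
    using eq by (simp add: algebra_simps)
  show "set_integrable lborel {a..b} (\<lambda>x. (A + (LINT s:{a..x}|lborel. g s)) * h x)"
    unfolding distrib_right using h I1 by (intro set_integral_add(1)) auto
qed

section \<open>Weak derivatives on an interval\<close>

lemma set_borel_measurable_mult:
  fixes f g :: "'a \<Rightarrow> real"
  assumes "set_borel_measurable M A f" "set_borel_measurable M A g"
  shows "set_borel_measurable M A (\<lambda>x. f x * g x)"
proof -
  have "(\<lambda>x. (indicator A x *\<^sub>R f x) * (indicator A x *\<^sub>R g x)) \<in> borel_measurable M"
    using assms unfolding set_borel_measurable_def by (rule borel_measurable_times)
  moreover have "(\<lambda>x. (indicator A x *\<^sub>R f x) * (indicator A x *\<^sub>R g x)) = (\<lambda>x. indicator A x *\<^sub>R (f x * g x))"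
    by (auto simp: indicator_def)
  ultimately show ?thesis by (simp only: set_borel_measurable_def)
qed

lemma set_integrable_imp_set_borel_measurable:
  "set_integrable M A f \<Longrightarrow> set_borel_measurable M A f"
  unfolding set_integrable_def set_borel_measurable_def by (rule borel_measurable_integrable)

lemma set_integral_cong_AE_set_borel:
  fixes f g :: "'a \<Rightarrow> real"
  assumes "set_borel_measurable M A f" "set_borel_measurable M A g" "AE x\<in>A in M. f x = g x"
  shows "(LINT x:A|M. f x) = (LINT x:A|M. g x)" "set_integrable M A f \<longleftrightarrow> set_integrable M A g"
proof -
  have *: "AE x in M. indicator A x *\<^sub>R f x = indicator A x *\<^sub>R g x"
    using assms(3) by eventually_elim (auto simp: indicator_def)
  show "(LINT x:A|M. f x) = (LINT x:A|M. g x)"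
    using assms * unfolding set_lebesgue_integral_def set_borel_measurable_def by (intro integral_cong_AE)
  show "set_integrable M A f \<longleftrightarrow> set_integrable M A g"
    using assms * unfolding set_integrable_def set_borel_measurable_def by (intro integrable_cong_AE)
qed

lemma set_integrable_integral_upto:
  fixes g :: "real \<Rightarrow> real"
  assumes "set_integrable lborel {a..b} g"
  shows "set_integrable lborel {a..b} (\<lambda>x. LINT s:{a..x}|lborel. g s)"
  using set_integral_by_parts(2)[OF assms, of "\<lambda>_. 1" 0] borel_integrable_atLeastAtMost'[of a b "\<lambda>_. 1::real"]
  by simp

lemma test_function_integral_deriv:
  assumes "test_function a b \<psi>" "a \<le> x"
  shows "(LINT s:{a..x}|lborel. deriv \<psi> s) = \<psi> x"
proof -
  have sm: "smooth \<psi>" and z: "\<psi> a = 0" using assms(1) by (auto simp: test_function_iff)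
  have "(LINT s:{a..x}|lborel. deriv \<psi> s) = \<psi> x - \<psi> a"
    using integral_FTC_Icc_real[of a x \<psi> "deriv \<psi>"] assms(2) smooth_has_derivative[OF sm]
      DERIV_isCont[OF smooth_has_derivative[OF smooth_deriv[OF sm]]]
    by (simp add: set_lebesgue_integral_def mult.commute)
  then show ?thesis using z by simp
qed

text \<open>A primitive of \<open>g\<close> has weak derivative \<open>g\<close>: in the integration
  by parts the boundary term vanishes because \<open>\<psi>\<close> is 0 at b.\<close>

lemma set_integral_integral_upto_deriv:
  assumes g: "set_integrable lborel {a..b} g" and \<psi>: "test_function a b \<psi>" and ab: "a < b"
  shows "(LINT x:{a..b}|lborel. (LINT s:{a..x}|lborel. g s) * deriv \<psi> x) = - (LINT x:{a..b}|lborel. g x * \<psi> x)"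
proof -
  have cont: "continuous_on {a..b} (deriv \<psi>)"
    using \<psi> by (simp add: test_function_iff smooth_continuous smooth_deriv)
  have "(LINT x:{a..b}|lborel. g x * (LINT s:{a..x}|lborel. deriv \<psi> s)) = (LINT x:{a..b}|lborel. g x * \<psi> x)"
    by (intro set_lebesgue_integral_cong) (auto simp: test_function_integral_deriv[OF \<psi>])
  moreover have "\<psi> b = 0" using \<psi> by (auto simp: test_function_iff)
  ultimately show ?thesis
    using set_integral_by_parts(1)[OF g borel_integrable_atLeastAtMost'[OF cont], of 0 0]
      test_function_integral_deriv[OF \<psi>, of b] ab
    by simp
qed

text \<open>The difference of f and the primitive of g has weak derivative 0, hence is constant. The
  family is fixed before f and g, so one null set of y can later serve all its members.\<close>

lemma ex_countable_test_functions_primitive: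
  fixes a b :: real
  assumes ab: "a < b"
  obtains \<Psi> where "countable \<Psi>" "\<And>\<psi>. \<psi> \<in> \<Psi> \<Longrightarrow> test_function a b \<psi>"
    "\<And>f g. set_integrable lborel {a..b} f \<Longrightarrow> set_integrable lborel {a..b} g \<Longrightarrow>
       (\<And>\<psi>. \<psi> \<in> \<Psi> \<Longrightarrow> (LINT x:{a..b}|lborel. f x * deriv \<psi> x) = - (LINT x:{a..b}|lborel. g x * \<psi> x)) \<Longrightarrow>
       \<exists>c. AE x\<in>{a..b} in lborel. f x = c + (LINT s:{a..x}|lborel. g s)"
proof -
  obtain \<Psi> where \<Psi>: "countable \<Psi>" "\<And>\<psi>. \<psi> \<in> \<Psi> \<Longrightarrow> test_function a b \<psi>"
    "\<And>h. set_integrable lborel {a..b} h \<Longrightarrow> (\<And>\<psi>. \<psi> \<in> \<Psi> \<Longrightarrow> (LINT x:{a..b}|lborel. h x * deriv \<psi> x) = 0)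
       \<Longrightarrow> \<exists>c. AE x\<in>{a..b} in lborel. h x = c"
    using ex_countable_test_functions_deriv[OF ab] by blast
  have "\<exists>c. AE x\<in>{a..b} in lborel. f x = c + (LINT s:{a..x}|lborel. g s)"
    if f: "set_integrable lborel {a..b} f" and g: "set_integrable lborel {a..b} g"
      and eq: "\<And>\<psi>. \<psi> \<in> \<Psi> \<Longrightarrow> (LINT x:{a..b}|lborel. f x * deriv \<psi> x) = - (LINT x:{a..b}|lborel. g x * \<psi> x)"
    for f g
  proof -
    note G = set_integrable_integral_upto[OF g]
    have "\<exists>c. AE x\<in>{a..b} in lborel. f x - (LINT s:{a..x}|lborel. g s) = c"
    proof (rule \<Psi>(3))
      show "set_integrable lborel {a..b} (\<lambda>x. f x - (LINT s:{a..x}|lborel. g s))"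
        using f G by (rule set_integral_diff(1))
      fix \<psi> assume \<psi>: "\<psi> \<in> \<Psi>"
      have cont: "continuous_on {a..b} (deriv \<psi>)"
        using \<Psi>(2)[OF \<psi>] by (simp add: test_function_iff smooth_continuous smooth_deriv)
      have "(LINT x:{a..b}|lborel. (f x - (LINT s:{a..x}|lborel. g s)) * deriv \<psi> x) =
          (LINT x:{a..b}|lborel. f x * deriv \<psi> x) - (LINT x:{a..b}|lborel. (LINT s:{a..x}|lborel. g s) * deriv \<psi> x)"
        unfolding left_diff_distrib
        by (rule set_integral_diff(2)[OF set_integrable_mult_continuous[OF f cont] set_integrable_mult_continuous[OF G cont]])
      then show "(LINT x:{a..b}|lborel. (f x - (LINT s:{a..x}|lborel. g s)) * deriv \<psi> x) = 0"
        using eq[OF \<psi>] set_integral_integral_upto_deriv[OF g \<Psi>(2)[OF \<psi>] ab] by simp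
    qed
    then obtain c where "AE x\<in>{a..b} in lborel. f x - (LINT s:{a..x}|lborel. g s) = c" ..
    then have "AE x\<in>{a..b} in lborel. f x = c + (LINT s:{a..x}|lborel. g s)"
      by eventually_elim auto
    then show ?thesis ..
  qed
  with \<Psi>(1,2) show thesis by (intro that[of \<Psi>]) auto
qed

lemma has_weak_deriv_primitive:
  assumes "has_weak_deriv a b f g" "a < b"
  obtains c where "AE x\<in>{a..b} in lborel. f x = c + (LINT s:{a..x}|lborel. g s)"
proof -
  obtain \<Psi> where "countable \<Psi>" and \<Psi>: "\<And>\<psi>. \<psi> \<in> \<Psi> \<Longrightarrow> test_function a b \<psi>"
    "\<And>f g. set_integrable lborel {a..b} f \<Longrightarrow> set_integrable lborel {a..b} g \<Longrightarrow>
       (\<And>\<psi>. \<psi> \<in> \<Psi> \<Longrightarrow> (LINT x:{a..b}|lborel. f x * deriv \<psi> x) = - (LINT x:{a..b}|lborel. g x * \<psi> x)) \<Longrightarrow>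
       \<exists>c. AE x\<in>{a..b} in lborel. f x = c + (LINT s:{a..x}|lborel. g s)"
    using ex_countable_test_functions_primitive[OF assms(2)] by blast
  have "\<exists>c. AE x\<in>{a..b} in lborel. f x = c + (LINT s:{a..x}|lborel. g s)"
    using assms(1) \<Psi>(1) unfolding has_weak_deriv_def by (intro \<Psi>(2)) blast+
  then show thesis using that by blast
qed

lemma has_weak_deriv_unique:
  assumes f: "has_weak_deriv a b f g" "has_weak_deriv a b f g'" and ab: "a < b"
  shows "AE x\<in>{a..b} in lborel. g x = g' x"
proof -
  obtain \<Phi> where "countable \<Phi>" and \<Phi>: "\<And>\<phi>. \<phi> \<in> \<Phi> \<Longrightarrow> test_function a b \<phi>"
    "\<And>h. set_integrable lborel {a..b} h \<Longrightarrow> (\<And>\<phi>. \<phi> \<in> \<Phi> \<Longrightarrow> (LINT x:{a..b}|lborel. h x * \<phi> x) = 0)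
       \<Longrightarrow> AE x\<in>{a..b} in lborel. h x = 0"
    using ex_countable_test_functions[OF ab] by blast
  have g: "set_integrable lborel {a..b} g" "set_integrable lborel {a..b} g'"
    using f by (auto simp: has_weak_deriv_def)
  have "AE x\<in>{a..b} in lborel. g x - g' x = 0"
  proof (rule \<Phi>(2))
    show "set_integrable lborel {a..b} (\<lambda>x. g x - g' x)" using g by (rule set_integral_diff(1))
    fix \<phi> assume \<phi>: "\<phi> \<in> \<Phi>"
    note cont = test_function_continuous[OF \<Phi>(1)[OF \<phi>]]
    have "(LINT x:{a..b}|lborel. (g x - g' x) * \<phi> x) = (LINT x:{a..b}|lborel. g x * \<phi> x) - (LINT x:{a..b}|lborel. g' x * \<phi> x)"
      unfolding left_diff_distrib
      by (rule set_integral_diff(2)[OF set_integrable_mult_continuous[OF g(1) cont] set_integrable_mult_continuous[OF g(2) cont]])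
    also have "(LINT x:{a..b}|lborel. g x * \<phi> x) = (LINT x:{a..b}|lborel. g' x * \<phi> x)"
      using f[unfolded has_weak_deriv_def, THEN conjunct2, THEN conjunct2, rule_format, OF \<Phi>(1)[OF \<phi>]]
      by simp
    finally show "(LINT x:{a..b}|lborel. (g x - g' x) * \<phi> x) = 0" by simp
  qed
  then show ?thesis by simp
qed

text \<open>\<open>weak_deriv\<close> is a mere choice. The boundary conditions are phrased with it,
  whereas the system supplies a derivative of its own.\<close>

lemma AE_weak_deriv_eq:
  assumes "has_weak_deriv 0 1 f g"
  shows "AE x\<in>{0..1} in lborel. weak_deriv f x = g x"
proof (rule has_weak_deriv_unique)
  show "has_weak_deriv 0 1 f (weak_deriv f)" unfolding weak_deriv_def
    by (rule someI[of "has_weak_deriv 0 1 f", OF assms])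
qed (use assms in simp_all)

section \<open>Boundary values and the sign of the flux integral\<close>

lemma abs_integral_upto_le:
  fixes g :: "real \<Rightarrow> real"
  assumes g: "set_integrable lborel {a..b} g" and x: "x \<in> {a..b}"
  shows "\<bar>LINT s:{a..x}|lborel. g s\<bar> \<le> (LINT s:{a..b}|lborel. \<bar>g s\<bar>)"
proof -
  have gx: "set_integrable lborel {a..x} g" using g by (rule set_integrable_subset) (use x in auto)
  have "\<bar>LINT s:{a..x}|lborel. g s\<bar> \<le> (LINT s:{a..x}|lborel. \<bar>g s\<bar>)"
    using set_integral_norm_bound[OF gx] by simp
  also have "\<dots> \<le> (LINT s:{a..b}|lborel. \<bar>g s\<bar>)"
    unfolding set_lebesgue_integral_def
    using set_integrable_abs[OF g] set_integrable_abs[OF gx] x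
    by (intro integral_mono) (auto simp: set_integrable_def indicator_def)
  finally show ?thesis .
qed

text \<open>The one-dimensional Sobolev embedding into bounded functions. It bounds
  \<open>1 / v\<close>, and so the diffusion coefficient, at a fixed time.\<close>

lemma has_weak_deriv_AE_bounded:
  assumes f: "has_weak_deriv a b f g" and ab: "a < b"
  obtains B where "AE x\<in>{a..b} in lborel. \<bar>f x\<bar> \<le> B"
proof -
  obtain c where "AE x\<in>{a..b} in lborel. f x = c + (LINT s:{a..x}|lborel. g s)"
    using has_weak_deriv_primitive[OF f ab] .
  then have "AE x\<in>{a..b} in lborel. \<bar>f x\<bar> \<le> \<bar>c\<bar> + (LINT s:{a..b}|lborel. \<bar>g s\<bar>)"
  proof eventually_elim
    case (elim x)
    have "set_integrable lborel {a..b} g" using f by (simp add: has_weak_deriv_def)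
    from abs_integral_upto_le[OF this, of x] show ?case using elim by auto
  qed
  then show thesis by (rule that)
qed

lemma continuous_on_integral_upto:
  fixes g :: "real \<Rightarrow> real"
  assumes g: "set_integrable lborel {a..b} g"
  shows "continuous_on {a..b} (\<lambda>x. LINT s:{a..x}|lborel. g s)"
proof -
  have "continuous_on {a..b} (\<lambda>x. integral {a..x} g)"
    using set_borel_integral_eq_integral(1)[OF g] by (rule indefinite_integral_continuous_1)
  moreover have eq: "integral {a..x} g = (LINT s:{a..x}|lborel. g s)" if "x \<in> {a..b}" for x
    using set_integrable_subset[OF g, of "{a..x}"] that
    by (intro set_borel_integral_eq_integral(2)[symmetric]) auto
  ultimately show ?thesis by (rule continuous_on_eq)
qed

lemma not_AE_notin_Ioo:
  fixes l u :: real
  assumes "l < u" shows "\<not> (AE y in lborel. y \<notin> {l<..<u})"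
proof
  assume "AE y in lborel. y \<notin> {l<..<u}"
  then have "emeasure lborel {y \<in> space lborel. \<not> y \<notin> {l<..<u}} = 0"
    by (subst (asm) AE_iff_measurable[OF _ refl]) auto
  moreover have "{y \<in> space lborel. \<not> y \<notin> {l<..<u}} = {l<..<u}" by auto
  ultimately show False using assms by simp
qed

text \<open>Transfers a vanishing trace from a gradient \<open>f\<close> to the continuous
  representative \<open>F\<close> of its flux. If F x were nonzero, \<bar>F\<bar> would exceed half
  that size near x but stay below it a.e. there, on a one-sided interval of positive
  measure.\<close>

lemma has_boundary_value_continuous:
  assumes cont: "continuous_on {a..b} F" and ab: "a < b" and x: "x \<in> {a, b}"
    and bv: "has_boundary_value a b f x 0" and B: "AE y\<in>{a..b} in lborel. \<bar>F y\<bar> \<le> B * \<bar>f y\<bar>"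
  shows "F x = 0"
proof (rule ccontr)
  assume ne: "F x \<noteq> 0"
  \<comment> \<open>Chosen so that B times it stays within half of \<bar>F x\<bar>; adding 1 keeps
    the denominator positive.\<close>
  define \<epsilon> where "\<epsilon> = \<bar>F x\<bar> / (2 * (\<bar>B\<bar> + 1))"
  have \<epsilon>: "\<epsilon> > 0" "\<bar>B\<bar> * \<epsilon> \<le> \<bar>F x\<bar> / 2" using ne by (auto simp: \<epsilon>_def field_simps)
  obtain d where d: "d > 0" "AE y\<in>{a<..<b} in lborel. \<bar>y - x\<bar> < d \<longrightarrow> \<bar>f y - 0\<bar> < \<epsilon>"
    using bv \<epsilon>(1) unfolding has_boundary_value_def by blast
  have "x \<in> {a..b}" using x ab by auto
  then obtain d' where d': "d' > 0" "\<And>y. y \<in> {a..b} \<Longrightarrow> dist y x < d' \<Longrightarrow> dist (F y) (F x) < \<bar>F x\<bar> / 2"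
    using cont ne unfolding continuous_on_iff by (meson zero_less_abs_iff half_gt_zero)
  define m where "m = min (b - a) (min d d')"
  have m: "m > 0" "m \<le> b - a" "m \<le> d" "m \<le> d'" using d d' ab by (auto simp: m_def)
  obtain l u where lu: "l < u" "{l<..<u} \<subseteq> {a<..<b} \<inter> {y. \<bar>y - x\<bar> < m}"
  proof (cases "x = a")
    case True then show ?thesis using m by (intro that[of a "a + m"]) auto
  next
    case False then show ?thesis using m x by (intro that[of "b - m" b]) auto
  qed
  have "AE y in lborel. y \<notin> {l<..<u}"
    using d(2) B
  proof eventually_elim
    case (elim y)
    show ?case
    proof
      assume "y \<in> {l<..<u}"
      then have y: "y \<in> {a<..<b}" "\<bar>y - x\<bar> < m" using lu by auto
      then have "\<bar>f y\<bar> < \<epsilon>" using elim m by auto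
      have "\<bar>F y\<bar> \<le> B * \<bar>f y\<bar>" using elim y by auto
      also have "\<dots> \<le> \<bar>B\<bar> * \<epsilon>" using \<open>\<bar>f y\<bar> < \<epsilon>\<close> by (intro mult_mono) auto
      also have "\<dots> \<le> \<bar>F x\<bar> / 2" by (rule \<epsilon>)
      finally have "\<bar>F y\<bar> \<le> \<bar>F x\<bar> / 2" .
      moreover have "\<bar>F y - F x\<bar> < \<bar>F x\<bar> / 2" using d'(2)[of y] y m by (auto simp: dist_real_def)
      ultimately show False by argo
    qed
  qed
  then show False using not_AE_notin_Ioo[OF lu(1)] by contradiction
qed

text \<open>Integration by parts gives [f J] minus the integral of k f'^2. It is applied to the
  primitives \<open>F\<close> and \<open>G\<close> that represent f and J, and the zero trace of f'
  kills the boundary term.\<close>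

lemma integral_mult_flux_deriv_nonpos:
  fixes a b :: real
  assumes ab: "a < b" and f: "has_weak_deriv a b f f'" and J: "has_weak_deriv a b J J'"
    and flux: "AE x\<in>{a..b} in lborel. J x = k x * f' x \<and> 0 \<le> k x \<and> k x \<le> B"
    and bv: "\<And>x. x \<in> {a, b} \<Longrightarrow> has_boundary_value a b f' x 0"
  shows "set_integrable lborel {a..b} (\<lambda>x. f x * J' x)" "(LINT x:{a..b}|lborel. f x * J' x) \<le> 0"
proof -
  have int: "set_integrable lborel {a..b} f" "set_integrable lborel {a..b} f'"
    "set_integrable lborel {a..b} J" "set_integrable lborel {a..b} J'"
    using f J by (auto simp: has_weak_deriv_def)
  note meas = int[THEN set_integrable_imp_set_borel_measurable]
  obtain c where c: "AE x\<in>{a..b} in lborel. f x = c + (LINT s:{a..x}|lborel. f' s)"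
    using has_weak_deriv_primitive[OF f ab] .
  obtain d where d: "AE x\<in>{a..b} in lborel. J x = d + (LINT s:{a..x}|lborel. J' s)"
    using has_weak_deriv_primitive[OF J ab] .
  define F where "F x = c + (LINT s:{a..x}|lborel. f' s)" for x
  define G where "G x = d + (LINT s:{a..x}|lborel. J' s)" for x
  have contF: "continuous_on {a..b} F" and contG: "continuous_on {a..b} G"
    unfolding F_def G_def by (intro continuous_intros continuous_on_integral_upto int)+
  have FJ: "set_integrable lborel {a..b} (\<lambda>x. F x * J' x)"
    using set_integrable_mult_continuous[OF int(4) contF] by (simp add: mult.commute)
  have f'G: "set_integrable lborel {a..b} (\<lambda>x. f' x * G x)"
    using set_integrable_mult_continuous[OF int(2) contG] .
  have AE_fF: "AE x\<in>{a..b} in lborel. f x * J' x = F x * J' x"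
    using c by eventually_elim (auto simp: F_def)
  note fJ = set_integral_cong_AE_set_borel[OF set_borel_measurable_mult[OF meas(1,4)]
      set_integrable_imp_set_borel_measurable[OF FJ] AE_fF]
  show "set_integrable lborel {a..b} (\<lambda>x. f x * J' x)" using FJ fJ(2) by blast
  have bound: "AE y\<in>{a..b} in lborel. \<bar>G y\<bar> \<le> B * \<bar>f' y\<bar>"
    using d flux
  proof eventually_elim
    case (elim y)
    show ?case
    proof
      assume "y \<in> {a..b}"
      then have "G y = k y * f' y" "0 \<le> k y" "k y \<le> B" using elim by (auto simp: G_def)
      then show "\<bar>G y\<bar> \<le> B * \<bar>f' y\<bar>" by (auto simp: abs_mult intro: mult_right_mono)
    qed
  qed
  have G0: "G x = 0" if "x \<in> {a, b}" for x
    using has_boundary_value_continuous[OF contG ab that bv[OF that] bound] .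
  have "AE x\<in>{a..b} in lborel. 0 \<le> f' x * G x"
    using d flux
  proof eventually_elim
    case (elim x)
    show ?case
    proof
      assume "x \<in> {a..b}"
      then have "f' x * G x = k x * (f' x)\<^sup>2" "0 \<le> k x" using elim by (auto simp: G_def power2_eq_square)
      then show "0 \<le> f' x * G x" by simp
    qed
  qed
  then have "(LINT x:{a..b}|lborel. f' x * G x) \<ge> 0"
    unfolding set_lebesgue_integral_def by (intro integral_nonneg_AE) (auto elim!: eventually_mono simp: indicator_def)
  moreover have "(LINT x:{a..b}|lborel. F x * J' x) + (LINT x:{a..b}|lborel. f' x * G x) = F b * G b - c * d"
    using set_integral_by_parts(1)[OF int(2,4), of c d] by (simp add: F_def G_def)
  \<comment> \<open>The boundary term of the partial integration is F b * G b - c * d, where d is G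
    at a: the primitive starts at a with an integral over one point.\<close>
  moreover have "d = 0"
  proof -
    have "(LINT s:{a..a}|lborel. J' s) = 0"
      unfolding set_lebesgue_integral_def
      using AE_lborel_singleton[of a] by (intro integral_eq_zero_AE) (auto elim!: eventually_mono)
    then show ?thesis using G0[of a] by (simp add: G_def)
  qed
  ultimately show "(LINT x:{a..b}|lborel. f x * J' x) \<le> 0"
    using G0[of b] fJ(1) by simp
qed

section \<open>Weak time derivatives and energy\<close>

text \<open>Extension by zero to the plane, so that Fubini and measurability for
  \<open>lborel \<Otimes>\<^sub>M lborel\<close> apply without set integrals.\<close>

definition cyl_ext :: "real \<Rightarrow> (real \<Rightarrow> real \<Rightarrow> real) \<Rightarrow> real \<Rightarrow> real \<Rightarrow> real" where
  "cyl_ext T f t y = indicator {0..T} t * (indicator {0..1} y * f t y)"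

lemma cyl_ext_eq: "cyl_ext T f t y = indicator (cyl T) (t, y) *\<^sub>R f t y"
  by (simp add: cyl_ext_def cyl_def indicator_times)

lemma cyl_measurable_iff:
  "cyl_measurable T f \<longleftrightarrow> (\<lambda>(t, y). cyl_ext T f t y) \<in> borel_measurable (lborel \<Otimes>\<^sub>M lborel)"
proof -
  have "(\<lambda>(t, y). cyl_ext T f t y) = (\<lambda>p. indicator (cyl T) p *\<^sub>R (case p of (t, y) \<Rightarrow> f t y))"
    by (auto simp: cyl_ext_eq)
  then show ?thesis by (simp add: cyl_measurable_def set_borel_measurable_def lborel_prod)
qed

lemma set_integrable_cyl_iff:
  "set_integrable lborel (cyl T) (\<lambda>(t, y). f t y) \<longleftrightarrow>
     integrable (lborel \<Otimes>\<^sub>M lborel) (\<lambda>(t, y). cyl_ext T f t y)"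
proof -
  have "(\<lambda>(t, y). cyl_ext T f t y) = (\<lambda>p. indicator (cyl T) p *\<^sub>R (case p of (t, y) \<Rightarrow> f t y))"
    by (auto simp: cyl_ext_eq)
  then show ?thesis by (simp add: set_integrable_def lborel_prod)
qed

lemma AE_cyl_AE:
  assumes "AE p\<in>cyl T in lborel. P (fst p) (snd p)"
  shows "AE t\<in>{0..T} in lborel. AE y\<in>{0..1} in lborel. P t y"
proof -
  have "AE p in lborel \<Otimes>\<^sub>M lborel. p \<in> cyl T \<longrightarrow> P (fst p) (snd p)"
    using assms unfolding lborel_prod .
  from lborel_pair.AE_pair[OF this] show ?thesis
    by eventually_elim (auto simp: cyl_def elim: eventually_mono)
qed

lemma AE_set_integrable_time_slice:
  assumes "integrable (lborel \<Otimes>\<^sub>M lborel) (\<lambda>(t, y). cyl_ext T f t y)"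
  shows "AE y\<in>{0..1} in lborel. set_integrable lborel {0..T} (\<lambda>t. f t y)"
  using lborel_pair.AE_integrable_snd[OF assms]
  by eventually_elim (auto simp: cyl_ext_def set_integrable_def)

text \<open>The exceptional sets of countably many test functions have a null union, after which the
  du Bois-Reymond lemma works on each remaining line. The constant is found line by line, without
  measurability in y.\<close>

lemma has_dt_AE_primitive:
  assumes f: "has_dt T f g" and T: "0 < T"
  shows "AE y\<in>{0..1} in lborel. \<exists>c. AE t\<in>{0..T} in lborel. f t y = c + (LINT s:{0..t}|lborel. g s y)"
proof -
  obtain \<Psi> where "countable \<Psi>" and \<Psi>: "\<And>\<psi>. \<psi> \<in> \<Psi> \<Longrightarrow> test_function 0 T \<psi>"
    "\<And>f g. set_integrable lborel {0..T} f \<Longrightarrow> set_integrable lborel {0..T} g \<Longrightarrow>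
       (\<And>\<psi>. \<psi> \<in> \<Psi> \<Longrightarrow> (LINT x:{0..T}|lborel. f x * deriv \<psi> x) = - (LINT x:{0..T}|lborel. g x * \<psi> x)) \<Longrightarrow>
       \<exists>c. AE x\<in>{0..T} in lborel. f x = c + (LINT s:{0..x}|lborel. g s)"
    using ex_countable_test_functions_primitive[OF T] by blast
  have "AE y in lborel. \<forall>\<psi>\<in>\<Psi>. y \<in> {0..1} \<longrightarrow>
      (LINT t:{0..T}|lborel. f t y * deriv \<psi> t) = - (LINT t:{0..T}|lborel. g t y * \<psi> t)"
    using f \<Psi>(1) by (subst AE_ball_countable[OF \<open>countable \<Psi>\<close>]) (auto simp: has_dt_def)
  moreover have "AE y\<in>{0..1} in lborel. set_integrable lborel {0..T} (\<lambda>t. f t y)"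
    "AE y\<in>{0..1} in lborel. set_integrable lborel {0..T} (\<lambda>t. g t y)"
    using f unfolding has_dt_def set_integrable_cyl_iff by (blast intro: AE_set_integrable_time_slice)+
  ultimately show ?thesis
  proof eventually_elim
    case (elim y)
    show ?case
    proof
      assume "y \<in> {0..1}"
      with elim show "\<exists>c. AE t\<in>{0..T} in lborel. f t y = c + (LINT s:{0..t}|lborel. g s y)"
        by (intro \<Psi>(2)) auto
    qed
  qed
qed

text \<open>Needed to identify the time derivative in the equation with the square integrable one
  from the regularity class.\<close>

lemma has_dt_unique:
  assumes f: "has_dt T f g" "has_dt T f g'" and T: "0 < T"
  shows "AE t\<in>{0..T} in lborel. AE y\<in>{0..1} in lborel. g t y = g' t y"
proof -
  obtain \<Phi> where "countable \<Phi>" and \<Phi>: "\<And>\<phi>. \<phi> \<in> \<Phi> \<Longrightarrow> test_function 0 T \<phi>"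
    "\<And>h. set_integrable lborel {0..T} h \<Longrightarrow> (\<And>\<phi>. \<phi> \<in> \<Phi> \<Longrightarrow> (LINT x:{0..T}|lborel. h x * \<phi> x) = 0)
       \<Longrightarrow> AE x\<in>{0..T} in lborel. h x = 0"
    using ex_countable_test_functions[OF T] by blast
  have eq: "AE y in lborel. \<forall>\<phi>\<in>\<Phi>. y \<in> {0..1} \<longrightarrow>
      (LINT t:{0..T}|lborel. f t y * deriv \<phi> t) = - (LINT t:{0..T}|lborel. h t y * \<phi> t)"
    if "has_dt T f h" for h
    using that \<Phi>(1) by (subst AE_ball_countable[OF \<open>countable \<Phi>\<close>]) (auto simp: has_dt_def)
  have int: "integrable (lborel \<Otimes>\<^sub>M lborel) (\<lambda>(t, y). cyl_ext T g t y)"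
    "integrable (lborel \<Otimes>\<^sub>M lborel) (\<lambda>(t, y). cyl_ext T g' t y)"
    using f by (auto simp: has_dt_def set_integrable_cyl_iff)
  have "AE y in lborel. AE t in lborel. cyl_ext T g t y = cyl_ext T g' t y"
    using eq[OF f(1)] eq[OF f(2)] int[THEN AE_set_integrable_time_slice]
  proof eventually_elim
    case (elim y)
    show ?case
    proof (cases "y \<in> {0..1}")
      case True
      have gy: "set_integrable lborel {0..T} (\<lambda>t. g t y)" "set_integrable lborel {0..T} (\<lambda>t. g' t y)"
        using elim True by auto
      have "AE t\<in>{0..T} in lborel. g t y - g' t y = 0"
      proof (rule \<Phi>(2))
        show "set_integrable lborel {0..T} (\<lambda>t. g t y - g' t y)" using gy by (rule set_integral_diff(1))
        fix \<phi> assume \<phi>: "\<phi> \<in> \<Phi>"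
        note cont = test_function_continuous[OF \<Phi>(1)[OF \<phi>]]
        have "(LINT t:{0..T}|lborel. (g t y - g' t y) * \<phi> t) =
            (LINT t:{0..T}|lborel. g t y * \<phi> t) - (LINT t:{0..T}|lborel. g' t y * \<phi> t)"
          unfolding left_diff_distrib
          by (rule set_integral_diff(2)[OF set_integrable_mult_continuous[OF gy(1) cont] set_integrable_mult_continuous[OF gy(2) cont]])
        also have "(LINT t:{0..T}|lborel. g t y * \<phi> t) = (LINT t:{0..T}|lborel. g' t y * \<phi> t)"
          using bspec[OF elim(1) \<phi>] bspec[OF elim(2) \<phi>] True by simp
        finally show "(LINT t:{0..T}|lborel. (g t y - g' t y) * \<phi> t) = 0" by simp
      qed
      then show ?thesis by eventually_elim (auto simp: cyl_ext_def indicator_def)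
    qed (simp add: cyl_ext_def)
  qed
  \<comment> \<open>The argument yields "for a.e. y, for a.e. t". Exchanging the two quantifiers
    needs a measurable set in the plane, which the extensions by zero provide.\<close>
  moreover have "{p \<in> space (lborel \<Otimes>\<^sub>M lborel). cyl_ext T g (fst p) (snd p) = cyl_ext T g' (fst p) (snd p)}
      \<in> sets (lborel \<Otimes>\<^sub>M lborel)"
    using int[THEN borel_measurable_integrable] by (intro borel_measurable_eq) (simp_all add: case_prod_beta')
  ultimately have "AE t in lborel. AE y in lborel. cyl_ext T g t y = cyl_ext T g' t y"
    by (subst lborel_pair.AE_commute)
  then show ?thesis
    by eventually_elim (auto simp: cyl_ext_def elim: eventually_mono)
qed

text \<open>Turns the Bochner norm into an ordinary plane integral by Tonelli.\<close>

lemma L2_Hk_square_integrable: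
  assumes "L2_Hk T k f"
  shows "integrable (lborel \<Otimes>\<^sub>M lborel) (\<lambda>(t, y). (cyl_ext T f t y)\<^sup>2)"
proof -
  have [measurable]: "(\<lambda>(t, y). cyl_ext T f t y) \<in> borel_measurable (lborel \<Otimes>\<^sub>M lborel)"
    using assms by (simp add: L2_Hk_def cyl_measurable_iff)
  \<comment> \<open>This is the summand j = 0 of the norm. It holds for every h, since the integral
    of a square is nonnegative even where it takes the default value 0.\<close>
  have le: "(LINT y:{0..1}|lborel. (h y)\<^sup>2) \<le> (Hk_norm k h)\<^sup>2" for h
  proof -
    have nn: "0 \<le> (LINT y:{0..1}|lborel. ((weak_deriv ^^ j) h y)\<^sup>2)" for j
      by (simp add: set_lebesgue_integral_def integral_nonneg_AE)
    have "(LINT y:{0..1}|lborel. ((weak_deriv ^^ 0) h y)\<^sup>2) \<le> (\<Sum>j\<le>k. LINT y:{0..1}|lborel. ((weak_deriv ^^ j) h y)\<^sup>2)"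
      by (rule member_le_sum) (use nn in auto)
    then show ?thesis by (simp add: Hk_norm_def sum_nonneg nn)
  qed
  have L2: "AE t\<in>{0..T} in lborel. L2 {0..1} (f t)"
    using assms by (cases k) (auto simp: L2_Hk_def elim: eventually_mono)
  have "(\<integral>\<^sup>+p. ennreal ((cyl_ext T f (fst p) (snd p))\<^sup>2) \<partial>(lborel \<Otimes>\<^sub>M lborel)) =
      (\<integral>\<^sup>+t. \<integral>\<^sup>+y. ennreal ((cyl_ext T f t y)\<^sup>2) \<partial>lborel \<partial>lborel)"
    by (subst lborel.nn_integral_fst[symmetric]) (simp_all add: case_prod_beta')
  also have "\<dots> \<le> (\<integral>\<^sup>+t\<in>{0..T}. ennreal ((Hk_norm k (f t))\<^sup>2) \<partial>lborel)"
  proof (rule nn_integral_mono_AE)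
    show "AE t in lborel. (\<integral>\<^sup>+y. ennreal ((cyl_ext T f t y)\<^sup>2) \<partial>lborel)
        \<le> ennreal ((Hk_norm k (f t))\<^sup>2) * indicator {0..T} t"
      using L2
    proof eventually_elim
      case (elim t)
      show ?case
      proof (cases "t \<in> {0..T}")
        case True
        then have "set_integrable lborel {0..1} (\<lambda>y. (f t y)\<^sup>2)" using elim by (simp add: L2_def)
        then have "(\<integral>\<^sup>+y. ennreal (indicator {0..1} y *\<^sub>R (f t y)\<^sup>2) \<partial>lborel) = ennreal (LINT y:{0..1}|lborel. (f t y)\<^sup>2)"
          unfolding set_lebesgue_integral_def set_integrable_def by (intro nn_integral_eq_integral) auto
        moreover have "(cyl_ext T f t y)\<^sup>2 = indicator {0..1} y *\<^sub>R (f t y)\<^sup>2" for y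
          using True by (simp add: cyl_ext_def indicator_def)
        ultimately show ?thesis using True le[of "f t"] by (simp add: ennreal_leI)
      qed (simp add: cyl_ext_def)
    qed
  qed
  also have "\<dots> < \<infinity>" using assms by (simp add: L2_Hk_def)
  finally show ?thesis
    by (intro integrableI_nonneg) (auto simp: case_prod_beta')
qed

section \<open>The energy identity: chain rule for squares and monotonicity in time\<close>

lemma square_eq_primitive:
  fixes z g :: "real \<Rightarrow> real"
  assumes g: "set_integrable lborel {0..T} g"
    and z: "AE t\<in>{0..T} in lborel. z t = c + (LINT s:{0..t}|lborel. g s)"
    and zm: "set_borel_measurable lborel {0..T} z"
  shows "AE t\<in>{0..T} in lborel. (z t)\<^sup>2 = c\<^sup>2 + 2 * (LINT s:{0..t}|lborel. z s * g s)"
  using z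
proof eventually_elim
  case (elim t)
  show ?case
  proof
    assume t: "t \<in> {0..T}"
    have gt: "set_integrable lborel {0..t} g" using g by (rule set_integrable_subset) (use t in auto)
    let ?F = "\<lambda>t. c + (LINT s:{0..t}|lborel. g s)"
    have F: "set_integrable lborel {0..t} (\<lambda>x. ?F x * g x)" by (rule set_integral_by_parts(2)[OF gt gt])
    have "(\<lambda>x. indicator {0..t} x *\<^sub>R z x) = (\<lambda>x. indicator {0..t} x *\<^sub>R (indicator {0..T} x *\<^sub>R z x))"
      using t by (auto simp: indicator_def)
    then have "set_borel_measurable lborel {0..t} z"
      using zm by (simp add: set_borel_measurable_def)
    then have "set_borel_measurable lborel {0..t} (\<lambda>x. z x * g x)"
      by (intro set_borel_measurable_mult set_integrable_imp_set_borel_measurable[OF gt])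
    moreover have "AE x\<in>{0..t} in lborel. z x * g x = ?F x * g x"
      using z by eventually_elim (use t in auto)
    ultimately have "(LINT s:{0..t}|lborel. z s * g s) = (LINT x:{0..t}|lborel. ?F x * g x)"
      by (intro set_integral_cong_AE_set_borel(1) set_integrable_imp_set_borel_measurable[OF F])
    moreover have "(LINT x:{0..t}|lborel. ?F x * g x) + (LINT x:{0..t}|lborel. g x * ?F x) = ?F t * ?F t - c * c"
      by (rule set_integral_by_parts(1)[OF gt gt])
    moreover have "z t = ?F t" using elim t by simp
    ultimately show "(z t)\<^sup>2 = c\<^sup>2 + 2 * (LINT s:{0..t}|lborel. z s * g s)"
      by (simp add: power2_eq_square mult.commute)
  qed
qed

text \<open>On a.e. line, Z(t)^2 - Z(s)^2 is twice the integral of Z g over ]s,t]. Integrating over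
  y and exchanging integrals leaves the spatial integrals of Z g, which \<open>diss\<close> makes
  nonpositive.\<close>

lemma energy_nonincreasing:
  fixes Z g :: "real \<Rightarrow> real \<Rightarrow> real"
  assumes T: "0 < T"
    and Zm [measurable]: "(\<lambda>(t, y). Z t y) \<in> borel_measurable (lborel \<Otimes>\<^sub>M lborel)"
    and gm [measurable]: "(\<lambda>(t, y). g t y) \<in> borel_measurable (lborel \<Otimes>\<^sub>M lborel)"
    and Zg: "integrable (lborel \<Otimes>\<^sub>M lborel) (\<lambda>(t, y). Z t y * g t y)"
    and prim: "AE y in lborel. set_integrable lborel {0..T} (\<lambda>t. g t y) \<and>
      (\<exists>c. AE t\<in>{0..T} in lborel. Z t y = c + (LINT s:{0..t}|lborel. g s y))"
    and sq: "AE t\<in>{0..T} in lborel. integrable lborel (\<lambda>y. (Z t y)\<^sup>2)"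
    and diss: "AE t\<in>{0..T} in lborel. (LINT y|lborel. Z t y * g t y) \<le> 0"
  shows "AE s\<in>{0..T} in lborel. AE t\<in>{0..T} in lborel. s \<le> t \<longrightarrow>
    (LINT y|lborel. (Z t y)\<^sup>2) \<le> (LINT y|lborel. (Z s y)\<^sup>2)"
proof -
  define Q where "Q t y = (LINT r|lborel. (if 0 \<le> r \<and> r \<le> t then Z r y * g r y else 0))" for t y
  have Qm [measurable]: "(\<lambda>(t, y). Q t y) \<in> borel_measurable (lborel \<Otimes>\<^sub>M lborel)"
    unfolding Q_def by measurable
  \<comment> \<open>By the chain rule this is the squared integration constant of the line, hence
    independent of t almost everywhere.\<close>
  define k where "k t y = (Z t y)\<^sup>2 - 2 * Q t y" for t y
  have km [measurable]: "(\<lambda>(t, y). k t y) \<in> borel_measurable (lborel \<Otimes>\<^sub>M lborel)"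
    unfolding k_def by measurable
  \<comment> \<open>The same constant recovered as a time average, which makes it measurable in y.
    The exchange of "a.e. y" and "a.e. t" below depends on that.\<close>
  define C where "C y = (LINT r|lborel. indicator {0..T} r * k r y) / T" for y
  have Cm [measurable]: "C \<in> borel_measurable lborel"
    unfolding C_def by measurable
  have "AE y in lborel. AE t in lborel. t \<in> {0..T} \<longrightarrow> k t y = C y"
    using prim
  proof eventually_elim
    case (elim y)
    then obtain c where g: "set_integrable lborel {0..T} (\<lambda>t. g t y)"
      and c: "AE t\<in>{0..T} in lborel. Z t y = c + (LINT s:{0..t}|lborel. g s y)" by blast
    have "(\<lambda>t. Z t y) \<in> borel_measurable lborel" by measurable
    then have "set_borel_measurable lborel {0..T} (\<lambda>t. Z t y)"
      unfolding set_borel_measurable_def by measurable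
    from square_eq_primitive[OF g c this]
    have k: "AE t in lborel. t \<in> {0..T} \<longrightarrow> k t y = c\<^sup>2"
    proof eventually_elim
      case (elim t)
      have "(LINT s:{0..t}|lborel. Z s y * g s y) = Q t y"
        unfolding Q_def set_lebesgue_integral_def
        by (intro Bochner_Integration.integral_cong) (auto simp: indicator_def)
      then show ?case using elim by (simp add: k_def)
    qed
    have "(LINT r|lborel. indicator {0..T} r * k r y) = (LINT r|lborel. indicator {0..T} r * c\<^sup>2)"
      by (rule integral_cong_AE) (measurable, use k in \<open>eventually_elim, auto simp: indicator_def\<close>)
    then have "C y = c\<^sup>2" using T by (simp add: C_def)
    then show ?case using k by simp
  qed
  moreover have "{p \<in> space (lborel \<Otimes>\<^sub>M lborel). fst p \<in> {0..T} \<longrightarrow> k (fst p) (snd p) = C (snd p)}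
      \<in> sets (lborel \<Otimes>\<^sub>M lborel)"
  proof -
    have [measurable]: "(\<lambda>p. k (fst p) (snd p)) \<in> borel_measurable (lborel \<Otimes>\<^sub>M lborel)"
      using km by (simp add: case_prod_beta')
    show ?thesis by measurable
  qed
  ultimately have k: "AE t in lborel. AE y in lborel. t \<in> {0..T} \<longrightarrow> k t y = C y"
    by (subst lborel_pair.AE_commute)
  have Zgy: "AE y in lborel. integrable lborel (\<lambda>t. Z t y * g t y)"
    by (rule lborel_pair.AE_integrable_snd[OF Zg])
  have main: "(LINT y|lborel. (Z t y)\<^sup>2) \<le> (LINT y|lborel. (Z s y)\<^sup>2)"
    if st: "s \<in> {0..T}" "t \<in> {0..T}" "s \<le> t"
      and ks: "AE y in lborel. k s y = C y" and kt: "AE y in lborel. k t y = C y"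
      and int_s: "integrable lborel (\<lambda>y. (Z s y)\<^sup>2)" and int_t: "integrable lborel (\<lambda>y. (Z t y)\<^sup>2)"
    for s t
  proof -
    define R where "R r y = (if s < r \<and> r \<le> t then Z r y * g r y else 0)" for r y
    have Rm [measurable]: "(\<lambda>(r, y). R r y) \<in> borel_measurable (lborel \<Otimes>\<^sub>M lborel)"
      unfolding R_def by measurable
    have R: "integrable (lborel \<Otimes>\<^sub>M lborel) (\<lambda>(r, y). R r y)"
      by (rule Bochner_Integration.integrable_bound[OF Zg Rm]) (auto simp: R_def)
    have "AE y in lborel. (Z t y)\<^sup>2 - (Z s y)\<^sup>2 = 2 * (LINT r|lborel. R r y)"
      using ks kt Zgy
    proof eventually_elim
      case (elim y)
      have int: "integrable lborel (\<lambda>r. if 0 \<le> r \<and> r \<le> u then Z r y * g r y else 0)" for u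
        by (rule Bochner_Integration.integrable_bound[OF elim(3)]) (auto simp: elim(3) intro: borel_measurable_integrable)
      have "Q t y - Q s y = (LINT r|lborel. (if 0 \<le> r \<and> r \<le> t then Z r y * g r y else 0) - (if 0 \<le> r \<and> r \<le> s then Z r y * g r y else 0))"
        unfolding Q_def by (rule Bochner_Integration.integral_diff[OF int int, symmetric])
      also have "\<dots> = (LINT r|lborel. R r y)"
        using st by (intro Bochner_Integration.integral_cong) (auto simp: R_def)
      finally show ?case using elim by (simp add: k_def)
    qed
    then have "(LINT y|lborel. (Z t y)\<^sup>2 - (Z s y)\<^sup>2) = (LINT y|lborel. 2 * (LINT r|lborel. R r y))"
      by (rule integral_cong_AE[rotated 2]) measurable
    also have "\<dots> = 2 * (LINT y|lborel. (LINT r|lborel. R r y))" by simp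
    also have "(LINT y|lborel. (LINT r|lborel. R r y)) = (LINT r|lborel. (LINT y|lborel. R r y))"
      by (rule lborel_pair.Fubini_integral[OF R])
    finally have "(LINT y|lborel. (Z t y)\<^sup>2) - (LINT y|lborel. (Z s y)\<^sup>2) = 2 * (LINT r|lborel. (LINT y|lborel. R r y))"
      using int_t int_s by simp
    moreover have "AE r in lborel. (LINT y|lborel. R r y) \<le> 0"
      using diss
    proof eventually_elim
      case (elim r)
      then show ?case using st by (cases "s < r"; cases "r \<le> t") (simp_all add: R_def)
    qed
    then have "0 \<le> (LINT r|lborel. - (LINT y|lborel. R r y))"
      by (intro integral_nonneg_AE) auto
    ultimately show ?thesis by simp
  qed
  \<comment> \<open>Goodness is a property of a single time, so s and t can be drawn independently
    from the same full-measure set.\<close>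
  have good: "AE t in lborel. t \<in> {0..T} \<longrightarrow> (AE y in lborel. k t y = C y) \<and> integrable lborel (\<lambda>y. (Z t y)\<^sup>2)"
    using k sq by eventually_elim auto
  show ?thesis
    using good
  proof eventually_elim
    case (elim s)
    show ?case
    proof
      assume s: "s \<in> {0..T}"
      from good show "AE t\<in>{0..T} in lborel. s \<le> t \<longrightarrow> (LINT y|lborel. (Z t y)\<^sup>2) \<le> (LINT y|lborel. (Z s y)\<^sup>2)"
        by eventually_elim (use elim s main in blast)
    qed
  qed
qed

section \<open>Entropy and energy\<close>

lemma AE_obtain_in_Ioo:
  fixes l u :: real
  assumes "AE x in lborel. P x" "l < u"
  obtains x where "l < x" "x < u" "P x"
proof -
  have "\<exists>x. l < x \<and> x < u \<and> P x"
  proof (rule ccontr)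
    assume "\<not> ?thesis"
    then have "AE x in lborel. x \<notin> {l<..<u}"
      using assms(1) by (auto elim!: eventually_mono)
    with not_AE_notin_Ioo[OF assms(2)] show False by contradiction
  qed
  then show thesis using that by blast
qed

lemma has_boundary_value_cong_AE:
  assumes "AE y\<in>{a..b} in lborel. f y = g y" "has_boundary_value a b f x c"
  shows "has_boundary_value a b g x c"
  unfolding has_boundary_value_def
proof (intro allI impI)
  fix e :: real assume "e > 0"
  then obtain d where d: "d > 0" "AE y\<in>{a<..<b} in lborel. \<bar>y - x\<bar> < d \<longrightarrow> \<bar>f y - c\<bar> < e"
    using assms(2) unfolding has_boundary_value_def by blast
  have "AE y\<in>{a<..<b} in lborel. \<bar>y - x\<bar> < d \<longrightarrow> \<bar>g y - c\<bar> < e"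
    using d(2) assms(1) by eventually_elim auto
  with d(1) show "\<exists>d>0. AE y\<in>{a<..<b} in lborel. \<bar>y - x\<bar> < d \<longrightarrow> \<bar>g y - c\<bar> < e" by blast
qed

section \<open>Comparing energies and entropy\<close>

lemma L2_set_integrable_diff_square:
  assumes f: "L2 S f" and g: "L2 S g"
  shows "set_integrable lborel S (\<lambda>x. (f x - g x)\<^sup>2)"
proof -
  have "integrable lborel (\<lambda>x. 2 * (indicator S x *\<^sub>R (f x)\<^sup>2) + 2 * (indicator S x *\<^sub>R (g x)\<^sup>2))"
    using f g by (simp add: L2_def set_integrable_def)
  then have "integrable lborel (\<lambda>x. (indicator S x *\<^sub>R f x - indicator S x *\<^sub>R g x)\<^sup>2)"
  proof (rule Bochner_Integration.integrable_bound)
    show "(\<lambda>x. (indicator S x *\<^sub>R f x - indicator S x *\<^sub>R g x)\<^sup>2) \<in> borel_measurable lborel"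
      using f g unfolding L2_def set_borel_measurable_def by (intro borel_measurable_power borel_measurable_diff) auto
    have "(p - q)\<^sup>2 \<le> 2 * p\<^sup>2 + 2 * q\<^sup>2" for p q :: real
      using zero_le_power2[of "p + q"] by (simp add: power2_eq_square algebra_simps)
    then show "AE x in lborel. norm ((indicator S x *\<^sub>R f x - indicator S x *\<^sub>R g x)\<^sup>2)
        \<le> norm (2 * (indicator S x *\<^sub>R (f x)\<^sup>2) + 2 * (indicator S x *\<^sub>R (g x)\<^sup>2))"
      by (intro AE_I2) (auto simp: indicator_def)
  qed
  moreover have "(\<lambda>x. (indicator S x *\<^sub>R f x - indicator S x *\<^sub>R g x)\<^sup>2) = (\<lambda>x. indicator S x *\<^sub>R (f x - g x)\<^sup>2)"
    by (auto simp: indicator_def)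
  ultimately show ?thesis by (simp only: set_integrable_def)
qed

lemma L2_square_integral_le:
  assumes f: "L2 S f" and g: "L2 S g"
  shows "(LINT x:S|lborel. (f x)\<^sup>2) \<le> 2 * (LINT x:S|lborel. (g x)\<^sup>2) + 2 * (LINT x:S|lborel. (f x - g x)\<^sup>2)"
proof -
  note int = L2_set_integrable_diff_square[OF f g]
  have fg: "set_integrable lborel S (\<lambda>x. (f x)\<^sup>2)" "set_integrable lborel S (\<lambda>x. (g x)\<^sup>2)"
    using f g by (auto simp: L2_def)
  have "(LINT x:S|lborel. (f x)\<^sup>2) \<le> (LINT x:S|lborel. 2 * (g x)\<^sup>2 + 2 * (f x - g x)\<^sup>2)"
  proof (rule set_integral_mono)
    fix x
    show "(f x)\<^sup>2 \<le> 2 * (g x)\<^sup>2 + 2 * (f x - g x)\<^sup>2"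
      \<comment> \<open>The right side minus the left side is exactly this square.\<close>
      using zero_le_power2[of "f x - 2 * g x"] by (simp add: power2_eq_square algebra_simps)
  qed (use int fg in \<open>auto intro!: set_integral_add(1)\<close>)
  also have "\<dots> = (LINT x:S|lborel. 2 * (g x)\<^sup>2) + (LINT x:S|lborel. 2 * (f x - g x)\<^sup>2)"
    by (rule set_integral_add(2)) (use int fg in auto)
  finally show ?thesis by simp
qed

text \<open>Continuity is used with the fixed tolerance 1 for the squared distance. The resulting
  comparison E \<le> 2E' + 2 is cruder than convergence of energies, but enough for a uniform
  bound.\<close>

lemma L2_continuous_square_integral_close:
  assumes F: "L2_continuous T F" and t: "t \<in> {0..T}"
  obtains d where "d > 0"
    "\<And>s. s \<in> {0..T} \<Longrightarrow> \<bar>s - t\<bar> < d \<Longrightarrow>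
       (LINT y:{0..1}|lborel. (F t y)\<^sup>2) \<le> 2 * (LINT y:{0..1}|lborel. (F s y)\<^sup>2) + 2"
    "\<And>s. s \<in> {0..T} \<Longrightarrow> \<bar>s - t\<bar> < d \<Longrightarrow>
       (LINT y:{0..1}|lborel. (F s y)\<^sup>2) \<le> 2 * (LINT y:{0..1}|lborel. (F t y)\<^sup>2) + 2"
proof -
  have L2: "L2 {0..1} (F s)" if "s \<in> {0..T}" for s using F that by (simp add: L2_continuous_def)
  have "((\<lambda>s. LINT y:{0..1}|lborel. (F s y - F t y)\<^sup>2) \<longlongrightarrow> 0) (at t within {0..T})"
    using F t by (simp add: L2_continuous_def)
  from order_tendstoD(2)[OF this, of 1]
  obtain d where d: "d > 0" "\<And>s. s \<in> {0..T} \<Longrightarrow> s \<noteq> t \<Longrightarrow> dist s t < d \<Longrightarrow> (LINT y:{0..1}|lborel. (F s y - F t y)\<^sup>2) < 1"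
    unfolding eventually_at by auto
  have close: "(LINT y:{0..1}|lborel. (F s y - F t y)\<^sup>2) \<le> 1" if "s \<in> {0..T}" "\<bar>s - t\<bar> < d" for s
    using d(2)[of s] that by (cases "s = t") (auto simp: dist_real_def)
  have sym: "(LINT y:{0..1}|lborel. (F t y - F s y)\<^sup>2) = (LINT y:{0..1}|lborel. (F s y - F t y)\<^sup>2)" for s
    by (simp add: power2_commute)
  show thesis
  proof (rule that[OF d(1)])
    fix s assume s: "s \<in> {0..T}" "\<bar>s - t\<bar> < d"
    show "(LINT y:{0..1}|lborel. (F t y)\<^sup>2) \<le> 2 * (LINT y:{0..1}|lborel. (F s y)\<^sup>2) + 2"
      using L2_square_integral_le[OF L2[OF t] L2[OF s(1)]] close[OF s] sym[of s] by linarith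
    show "(LINT y:{0..1}|lborel. (F s y)\<^sup>2) \<le> 2 * (LINT y:{0..1}|lborel. (F t y)\<^sup>2) + 2"
      using L2_square_integral_le[OF L2[OF s(1)] L2[OF t]] close[OF s] by linarith
  qed
qed

text \<open>In HOL \<open>ln (- x) = ln x\<close>, so the inequality covers negative \<open>x\<close> as well.\<close>

lemma abs_mult_ln_le: "\<bar>x * ln x\<bar> \<le> x\<^sup>2 + 1" for x :: real
proof -
  have pos: "\<bar>x * ln x\<bar> \<le> x\<^sup>2 + 1" if x: "x > 0" for x :: real
  proof -
    have "ln x \<le> x - 1" using x by (rule ln_le_minus_one)
    then have "x * ln x \<le> x * (x - 1)" using x by (intro mult_left_mono) auto
    \<comment> \<open>The lower bound comes from the same inequality at 1/x: multiplied by x it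
      gives - x ln x \<le> 1 - x.\<close>
    moreover have "- ln x \<le> 1 / x - 1"
      using ln_le_minus_one[of "1 / x"] x by (simp add: ln_div)
    then have "x * (- ln x) \<le> x * (1 / x - 1)" using x by (intro mult_left_mono) auto
    then have "- (x * ln x) \<le> 1 - x" using x by (simp add: algebra_simps)
    moreover have "x * (x - 1) = x\<^sup>2 - x" by (simp add: power2_eq_square algebra_simps)
    moreover have "0 \<le> x\<^sup>2" by simp
    ultimately show ?thesis using x unfolding abs_le_iff by linarith
  qed
  consider "x > 0" | "x = 0" | "- x > 0" by linarith
  then show ?thesis
  proof cases
    case 3
    then show ?thesis using pos[of "- x"] ln_minus[of x] by simp
  qed (use pos in auto)
qed

text \<open>Each of the two terms of the entropy is at most E + 1; for the second, the square of the
  mean must first be bounded by E.\<close>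

lemma Ent_le_square_integral:
  assumes f: "L2 {0..1} f" and E: "(LINT y:{0..1}|lborel. (f y)\<^sup>2) \<le> E"
  shows "Ent f \<le> 2 * E + 2"
proof -
  let ?m = "LINT y:{0..1}|lborel. f y"
  have one: "set_integrable lborel {0..1} (\<lambda>y::real. c::real)" for c by (intro borel_integrable_atLeastAtMost') auto
  have sq: "set_integrable lborel {0..1} (\<lambda>y. (f y)\<^sup>2)" and fm: "set_borel_measurable lborel {0..1} f"
    using f by (auto simp: L2_def)
  have fi: "set_integrable lborel {0..1} f"
  proof -
    have "set_integrable lborel {0..1} (\<lambda>y. (f y)\<^sup>2 + 1)" using sq one by (rule set_integral_add(1))
    then show ?thesis
    proof (rule set_integrable_bound)
      have "\<bar>p\<bar> \<le> p\<^sup>2 + 1" for p :: real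
        using zero_le_power2[of "\<bar>p\<bar> - 1"] by (simp add: power2_eq_square algebra_simps)
      then show "AE y in lborel. y \<in> {0..1} \<longrightarrow> norm (f y) \<le> norm ((f y)\<^sup>2 + 1)"
        by (intro AE_I2) (auto intro: order_trans)
    qed (rule fm)
  qed
  have mf: "set_integrable lborel {0..1} (\<lambda>y. (- 2 * ?m) * f y)"
    using fi by (intro set_integrable_mult_right)
  \<comment> \<open>The variance on the probability space [0,1] is nonnegative, so the squared mean
    is at most the mean square.\<close>
  have "0 \<le> (LINT y:{0..1}|lborel. (f y - ?m)\<^sup>2)"
    by (simp add: set_lebesgue_integral_def integral_nonneg_AE)
  also have "\<dots> = (LINT y:{0..1}|lborel. (f y)\<^sup>2 + ((- 2 * ?m) * f y + ?m\<^sup>2))"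
    by (intro arg_cong[where f="set_lebesgue_integral lborel {0..1}"] ext)
      (simp add: power2_eq_square algebra_simps)
  also have "\<dots> = (LINT y:{0..1}|lborel. (f y)\<^sup>2) + (LINT y:{0..1}|lborel. (- 2 * ?m) * f y + ?m\<^sup>2)"
    by (rule set_integral_add(2)[OF sq set_integral_add(1)[OF mf one]])
  also have "(LINT y:{0..1}|lborel. (- 2 * ?m) * f y + ?m\<^sup>2) = (LINT y:{0..1}|lborel. (- 2 * ?m) * f y) + (LINT y:{0..1::real}|lborel. ?m\<^sup>2)"
    by (intro set_integral_add(2) mf one)
  also have "(LINT y:{0..1}|lborel. (- 2 * ?m) * f y) = (- 2 * ?m) * ?m"
    by (rule set_integral_mult_right)
  also have "(LINT y:{0..1::real}|lborel. ?m\<^sup>2) = ?m\<^sup>2"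
    by (simp add: set_lebesgue_integral_def)
  finally have m: "?m\<^sup>2 \<le> E" using E by (simp add: power2_eq_square)
  have "(LINT y:{0..1}|lborel. f y * ln (f y)) \<le> E + 1"
  proof (cases "set_integrable lborel {0..1} (\<lambda>y. f y * ln (f y))")
    case True
    have "(LINT y:{0..1}|lborel. f y * ln (f y)) \<le> (LINT y:{0..1}|lborel. (f y)\<^sup>2 + 1)"
      using True set_integral_add(1)[OF sq one[of 1]]
      by (rule set_integral_mono) (use abs_mult_ln_le in \<open>auto simp: abs_le_iff\<close>)
    also have "\<dots> = (LINT y:{0..1}|lborel. (f y)\<^sup>2) + 1"
      using set_integral_add(2)[OF sq one[of 1]] by (simp add: set_lebesgue_integral_def)
    finally show ?thesis using E by simp
  next
    \<comment> \<open>The integral would take the default value 0, and 0 \<le> E + 1 follows from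
      the bound on the mean. Splitting cases saves a measurability argument for f ln f.\<close>
    case False
    then have "(LINT y:{0..1}|lborel. f y * ln (f y)) = 0"
      by (simp add: set_integrable_def set_lebesgue_integral_def not_integrable_integral_eq)
    then show ?thesis using m zero_le_power2[of ?m] by linarith
  qed
  moreover have "- (?m * ln ?m) \<le> ?m\<^sup>2 + 1" using abs_mult_ln_le[of ?m] by linarith
  ultimately show ?thesis using m unfolding Ent_def by linarith
qed

section \<open>Dissipation and the energy bound for the reactant\<close>

lemma reaction_rate_nonneg:
  assumes "reaction_rate \<alpha> A \<theta>ign \<phi>" shows "0 \<le> \<phi> x"
proof -
  consider "x < \<theta>ign" | "x = \<theta>ign" | "\<theta>ign < x" by linarith
  then show ?thesis using assms by cases (auto simp: reaction_rate_def)
qed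

text \<open>At a fixed time Z g is Z times the flux derivative minus K \<phi> Z^2. The reaction term
  has a sign, and the flux term is handled by parts.\<close>

lemma reactant_dissipation:
  assumes sys: "combustion_system a \<mu> \<nu> q K D \<phi> T v u \<theta> Z"
    and reg_v: "Linf_Hk T 1 (\<lambda>t y. inverse (v t y) - 1)"
    and bc: "boundary_conditions T u \<theta> Z"
    and \<phi>: "\<And>x. 0 \<le> \<phi> x" and K: "0 < K" and D: "0 < D" and T: "0 < T"
    and g: "has_dt T Z g"
    and int: "AE t\<in>{0..T} in lborel. set_integrable lborel {0..1} (\<lambda>y. Z t y * g t y)"
  shows "AE t\<in>{0..T} in lborel. (LINT y:{0..1}|lborel. Z t y * g t y) \<le> 0"
proof -
  obtain v_t u_t E_t u_y pres_y visc_y work_y viscwork_y heat_y :: "real \<Rightarrow> real \<Rightarrow> real"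
    and Z_t Z_y diff_y where
    Z_t: "has_dt T Z Z_t" and Z_y: "has_dy T Z Z_y"
    and diff: "has_dy T (\<lambda>t y. D / (v t y)\<^sup>2 * Z_y t y) diff_y"
    and pde: "AE p\<in>cyl T in lborel. case p of (t, y) \<Rightarrow>
           v_t t y - u_y t y = 0 \<and>
           u_t t y + pres_y t y = visc_y t y \<and>
           E_t t y + work_y t y = viscwork_y t y + heat_y t y + q * K * \<phi> (\<theta> t y) * Z t y \<and>
           Z_t t y + K * \<phi> (\<theta> t y) * Z t y = diff_y t y"
    using sys unfolding combustion_system_def by (elim exE conjE) (rule that)
  have "AE p\<in>cyl T in lborel.
      Z_t (fst p) (snd p) + K * \<phi> (\<theta> (fst p) (snd p)) * Z (fst p) (snd p) = diff_y (fst p) (snd p)"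
    using pde by eventually_elim auto
  \<comment> \<open>The equation is restated with \<open>g\<close>, the derivative for which the
    product with \<open>Z\<close> is known to be integrable.\<close>
  from AE_cyl_AE[OF this] has_dt_unique[OF g Z_t T]
  have pde': "AE t\<in>{0..T} in lborel. AE y\<in>{0..1} in lborel. g t y + K * \<phi> (\<theta> t y) * Z t y = diff_y t y"
  proof eventually_elim
    case (elim t)
    show ?case
    proof
      assume "t \<in> {0..T}"
      with elim have "AE y\<in>{0..1} in lborel. Z_t t y + K * \<phi> (\<theta> t y) * Z t y = diff_y t y"
        "AE y\<in>{0..1} in lborel. g t y = Z_t t y" by auto
      then show "AE y\<in>{0..1} in lborel. g t y + K * \<phi> (\<theta> t y) * Z t y = diff_y t y"
        by eventually_elim auto
    qed
  qed
  have Zy: "AE t\<in>{0..T} in lborel. has_weak_deriv 0 1 (Z t) (Z_y t)" using Z_y by (simp add: has_dy_def)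
  have Jy: "AE t\<in>{0..T} in lborel. has_weak_deriv 0 1 (\<lambda>y. D / (v t y)\<^sup>2 * Z_y t y) (diff_y t)"
    using diff by (simp add: has_dy_def)
  have vH: "AE t\<in>{0..T} in lborel. Hk 1 (\<lambda>y. inverse (v t y) - 1)" using reg_v by (simp add: Linf_Hk_def)
  show ?thesis
    using pde' Zy Jy vH int bc[unfolded boundary_conditions_def]
  proof eventually_elim
    case (elim t)
    show ?case
    proof
      assume t: "t \<in> {0..T}"
      have Z: "has_weak_deriv 0 1 (Z t) (Z_y t)" and J: "has_weak_deriv 0 1 (\<lambda>y. D / (v t y)\<^sup>2 * Z_y t y) (diff_y t)"
        using elim t by auto
      obtain h where h: "has_weak_deriv 0 1 (\<lambda>y. inverse (v t y) - 1) h" using elim t by auto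
      \<comment> \<open>This bound may depend on t: it serves only to transfer the zero trace from
        \<open>Z_y\<close> to the flux and does not enter the final estimate.\<close>
      obtain B where B: "AE y\<in>{0..1} in lborel. \<bar>inverse (v t y) - 1\<bar> \<le> B"
        using has_weak_deriv_AE_bounded[OF h] by auto
      have flux: "AE y\<in>{0..1} in lborel. D / (v t y)\<^sup>2 * Z_y t y = (D / (v t y)\<^sup>2) * Z_y t y \<and>
          0 \<le> D / (v t y)\<^sup>2 \<and> D / (v t y)\<^sup>2 \<le> D * (B + 1)\<^sup>2"
        using B
      proof eventually_elim
        case (elim y)
        show ?case
        proof
          assume "y \<in> {0..1}"
          with elim have "\<bar>inverse (v t y) - 1\<bar> \<le> B" by blast
          then have "\<bar>inverse (v t y)\<bar> \<le> \<bar>B + 1\<bar>" by linarith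
          then have "(inverse (v t y))\<^sup>2 \<le> (B + 1)\<^sup>2" by (rule abs_le_square_iff[THEN iffD1])
          then have "D * (inverse (v t y))\<^sup>2 \<le> D * (B + 1)\<^sup>2" using D by (intro mult_left_mono) auto
          moreover have "D / (v t y)\<^sup>2 = D * (inverse (v t y))\<^sup>2" by (simp add: divide_inverse power_inverse)
          ultimately show "D / (v t y)\<^sup>2 * Z_y t y = (D / (v t y)\<^sup>2) * Z_y t y \<and>
              0 \<le> D / (v t y)\<^sup>2 \<and> D / (v t y)\<^sup>2 \<le> D * (B + 1)\<^sup>2" using D by simp
        qed
      qed
      have bv: "has_boundary_value 0 1 (Z_y t) x 0" if "x \<in> {0, 1}" for x
        using has_boundary_value_cong_AE[OF AE_weak_deriv_eq[OF Z]] elim t that by auto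
      note flux_int = integral_mult_flux_deriv_nonpos[OF zero_less_one Z J flux bv]
      have "(LINT y:{0..1}|lborel. Z t y * g t y) \<le> (LINT y:{0..1}|lborel. Z t y * diff_y t y)"
      proof (rule set_integral_mono_AE)
        show "set_integrable lborel {0..1} (\<lambda>y. Z t y * g t y)" using elim t by auto
        show "set_integrable lborel {0..1} (\<lambda>y. Z t y * diff_y t y)" by (rule flux_int(1))
        have "AE y\<in>{0..1} in lborel. g t y + K * \<phi> (\<theta> t y) * Z t y = diff_y t y" using elim t by auto
        then show "AE y\<in>{0..1} in lborel. Z t y * g t y \<le> Z t y * diff_y t y"
        proof eventually_elim
          case (elim y)
          have "0 \<le> K * \<phi> (\<theta> t y) * (Z t y)\<^sup>2" using K \<phi> by simp
          then have "Z t y * g t y \<le> Z t y * (g t y + K * \<phi> (\<theta> t y) * Z t y)"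
            by (simp add: power2_eq_square algebra_simps)
          with elim show ?case by (metis (no_types))
        qed
      qed
      also have "\<dots> \<le> 0" by (rule flux_int(2))
      finally show "(LINT y:{0..1}|lborel. Z t y * g t y) \<le> 0" .
    qed
  qed
qed

text \<open>Feeds the extensions by zero of \<open>Z\<close> and its derivative into the abstract
  energy argument.\<close>

lemma reactant_energy_nonincreasing:
  assumes sol: "generalised_solution a \<mu> \<nu> q K D \<phi> T v0 u0 \<theta>0 Z0 v u \<theta> Z"
    and bc: "boundary_conditions T u \<theta> Z"
    and \<phi>: "\<And>x. 0 \<le> \<phi> x" and K: "0 < K" and D: "0 < D" and T: "0 < T"
  shows "AE s\<in>{0..T} in lborel. AE t\<in>{0..T} in lborel. s \<le> t \<longrightarrow>
    (LINT y:{0..1}|lborel. (Z t y)\<^sup>2) \<le> (LINT y:{0..1}|lborel. (Z s y)\<^sup>2)"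
proof -
  have sys: "combustion_system a \<mu> \<nu> q K D \<phi> T v u \<theta> Z" and reg_v: "Linf_Hk T 1 (\<lambda>t y. inverse (v t y) - 1)"
    and LZ: "L2_Hk T 2 Z"
    using sol by (auto simp: generalised_solution_def)
  \<comment> \<open>Taken from the regularity class, since square integrability of \<open>g\<close>
    and \<open>Z\<close> makes their product integrable on the plane.\<close>
  obtain g where g: "has_dt T Z g" and Lg: "L2_Hk T 0 g"
    using sol unfolding generalised_solution_def by blast
  let ?Z = "cyl_ext T Z" and ?g = "cyl_ext T g"
  have Z2: "integrable (lborel \<Otimes>\<^sub>M lborel) (\<lambda>(t, y). (?Z t y)\<^sup>2)"
    and g2: "integrable (lborel \<Otimes>\<^sub>M lborel) (\<lambda>(t, y). (?g t y)\<^sup>2)"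
    using L2_Hk_square_integrable LZ Lg by blast+
  have Zm: "(\<lambda>(t, y). ?Z t y) \<in> borel_measurable (lborel \<Otimes>\<^sub>M lborel)"
    and gm: "(\<lambda>(t, y). ?g t y) \<in> borel_measurable (lborel \<Otimes>\<^sub>M lborel)"
    using LZ Lg by (auto simp: L2_Hk_def cyl_measurable_iff)
  have Zg: "integrable (lborel \<Otimes>\<^sub>M lborel) (\<lambda>(t, y). ?Z t y * ?g t y)"
  proof (rule Bochner_Integration.integrable_bound[OF Bochner_Integration.integrable_add[OF Z2 g2]])
    show "(\<lambda>(t, y). ?Z t y * ?g t y) \<in> borel_measurable (lborel \<Otimes>\<^sub>M lborel)"
      using borel_measurable_times[OF Zm gm] by (simp add: case_prod_beta')
    have "\<bar>p * r\<bar> \<le> p\<^sup>2 + r\<^sup>2" for p r :: real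
    proof -
      have "2 * (\<bar>p\<bar> * \<bar>r\<bar>) \<le> p\<^sup>2 + r\<^sup>2"
        using zero_le_power2[of "\<bar>p\<bar> - \<bar>r\<bar>"] by (simp add: power2_diff)
      moreover have "0 \<le> \<bar>p\<bar> * \<bar>r\<bar>" by simp
      ultimately show ?thesis unfolding abs_mult by linarith
    qed
    then show "AE p in lborel \<Otimes>\<^sub>M lborel. norm (case p of (t, y) \<Rightarrow> ?Z t y * ?g t y)
        \<le> norm ((case p of (t, y) \<Rightarrow> (?Z t y)\<^sup>2) + (case p of (t, y) \<Rightarrow> (?g t y)\<^sup>2))"
      by (intro AE_I2) (auto simp: case_prod_beta')
  qed
  have slice: "(LINT y|lborel. ?Z t y * ?g t y) = (LINT y:{0..1}|lborel. Z t y * g t y)"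
    "integrable lborel (\<lambda>y. ?Z t y * ?g t y) \<longleftrightarrow> set_integrable lborel {0..1} (\<lambda>y. Z t y * g t y)"
    "(LINT y|lborel. (?Z t y)\<^sup>2) = (LINT y:{0..1}|lborel. (Z t y)\<^sup>2)"
    if "t \<in> {0..T}" for t
  proof -
    have "(\<lambda>y. ?Z t y * ?g t y) = (\<lambda>y. indicator {0..1} y *\<^sub>R (Z t y * g t y))"
      "(\<lambda>y. (?Z t y)\<^sup>2) = (\<lambda>y. indicator {0..1} y *\<^sub>R (Z t y)\<^sup>2)"
      using that by (auto simp: cyl_ext_def indicator_def)
    then show "(LINT y|lborel. ?Z t y * ?g t y) = (LINT y:{0..1}|lborel. Z t y * g t y)"
      "integrable lborel (\<lambda>y. ?Z t y * ?g t y) \<longleftrightarrow> set_integrable lborel {0..1} (\<lambda>y. Z t y * g t y)"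
      "(LINT y|lborel. (?Z t y)\<^sup>2) = (LINT y:{0..1}|lborel. (Z t y)\<^sup>2)"
      by (simp_all only: set_lebesgue_integral_def set_integrable_def)
  qed
  have "AE s\<in>{0..T} in lborel. AE t\<in>{0..T} in lborel. s \<le> t \<longrightarrow>
      (LINT y|lborel. (?Z t y)\<^sup>2) \<le> (LINT y|lborel. (?Z s y)\<^sup>2)"
  proof (rule energy_nonincreasing[OF T Zm gm Zg])
    have gi: "integrable (lborel \<Otimes>\<^sub>M lborel) (\<lambda>(t, y). cyl_ext T g t y)"
      using g by (simp add: has_dt_def set_integrable_cyl_iff)
    show "AE y in lborel. set_integrable lborel {0..T} (\<lambda>t. ?g t y) \<and>
        (\<exists>c. AE t\<in>{0..T} in lborel. ?Z t y = c + (LINT s:{0..t}|lborel. ?g s y))"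
      using has_dt_AE_primitive[OF g T] AE_set_integrable_time_slice[OF gi]
    proof eventually_elim
      case (elim y)
      show ?case
      proof (cases "y \<in> {0..1}")
        case True
        then obtain c where c: "AE t\<in>{0..T} in lborel. Z t y = c + (LINT s:{0..t}|lborel. g s y)"
          and gy: "set_integrable lborel {0..T} (\<lambda>t. g t y)" using elim by blast
        have g_eq: "(LINT s:{0..t}|lborel. ?g s y) = (LINT s:{0..t}|lborel. g s y)" if "t \<in> {0..T}" for t
          using that True by (intro set_lebesgue_integral_cong) (auto simp: cyl_ext_def)
        have "AE t\<in>{0..T} in lborel. ?Z t y = c + (LINT s:{0..t}|lborel. ?g s y)"
          using c
        proof eventually_elim
          case (elim t)
          then show ?case using True g_eq[of t] by (auto simp: cyl_ext_def[of T Z])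
        qed
        moreover have "set_integrable lborel {0..T} (\<lambda>t. ?g t y) \<longleftrightarrow> set_integrable lborel {0..T} (\<lambda>t. g t y)"
          using True by (intro set_integrable_cong) (auto simp: cyl_ext_def)
        ultimately show ?thesis using gy by blast
      next
        case False
        \<comment> \<open>For y off [0,1] both extensions vanish identically and c = 0
          serves.\<close>
        then show ?thesis by (auto simp: cyl_ext_def set_integrable_def set_lebesgue_integral_def)
      qed
    qed
    show "AE t\<in>{0..T} in lborel. integrable lborel (\<lambda>y. (?Z t y)\<^sup>2)"
      using lborel_pair.AE_integrable_fst[OF Z2] by eventually_elim simp
    have "AE t\<in>{0..T} in lborel. set_integrable lborel {0..1} (\<lambda>y. Z t y * g t y)"
      using lborel_pair.AE_integrable_fst[OF Zg] by eventually_elim (use slice(2) in blast)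
    from reactant_dissipation[OF sys reg_v bc \<phi> K D T g this]
    show "AE t\<in>{0..T} in lborel. (LINT y|lborel. ?Z t y * ?g t y) \<le> 0"
      by eventually_elim (simp add: slice(1))
  qed
  then show ?thesis
  proof eventually_elim
    case (elim s)
    show ?case
    proof
      assume s: "s \<in> {0..T}"
      with elim have "AE t\<in>{0..T} in lborel. s \<le> t \<longrightarrow> (LINT y|lborel. (?Z t y)\<^sup>2) \<le> (LINT y|lborel. (?Z s y)\<^sup>2)" by blast
      then show "AE t\<in>{0..T} in lborel. s \<le> t \<longrightarrow>
          (LINT y:{0..1}|lborel. (Z t y)\<^sup>2) \<le> (LINT y:{0..1}|lborel. (Z s y)\<^sup>2)"
        by eventually_elim (use s slice(3) in simp)
    qed
  qed
qed

text \<open>A chain of times: from 0 to a good s by continuity of the trace representative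
  \<open>F\<close>, from s to a good r by monotonicity, and from r to t by continuity of
  \<open>Z\<close>.\<close>

lemma reactant_square_integral_le:
  assumes sol: "generalised_solution a \<mu> \<nu> q K D \<phi> T v0 u0 \<theta>0 Z0 v u \<theta> Z"
    and bc: "boundary_conditions T u \<theta> Z"
    and \<phi>: "\<And>x. 0 \<le> \<phi> x" and K: "0 < K" and D: "0 < D" and T: "0 < T"
    and Z0: "AE y\<in>{0..1} in lborel. 0 \<le> Z0 y \<and> Z0 y \<le> 1"
    and cont: "L2_continuous T Z" and t: "t \<in> {0..T}"
  shows "(LINT y:{0..1}|lborel. (Z t y)\<^sup>2) \<le> 10"
proof -
  let ?E = "\<lambda>f. LINT y:{0..1}|lborel. (f y)\<^sup>2 :: real"
  obtain F where F: "L2_continuous T F" "AE p\<in>cyl T in lborel. F (fst p) (snd p) = Z (fst p) (snd p)"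
    "AE y\<in>{0..1} in lborel. F 0 y = Z0 y"
    using sol by (auto simp: generalised_solution_def has_initial_trace_def)
  have L2: "L2 {0..1} (F s)" "L2 {0..1} (Z s)" if "s \<in> {0..T}" for s
    using F(1) cont that by (auto simp: L2_continuous_def)
  \<comment> \<open>\<open>F\<close> and \<open>Z\<close> are both continuous in time but are only
    known to agree a.e. on the cylinder; energies are exchanged at almost every time.\<close>
  have FZ: "AE s\<in>{0..T} in lborel. ?E (F s) = ?E (Z s)"
    using AE_cyl_AE[OF F(2)]
  proof eventually_elim
    case (elim s)
    show ?case
    proof
      assume s: "s \<in> {0..T}"
      with elim have "AE y\<in>{0..1} in lborel. F s y = Z s y" by blast
      then have "AE y\<in>{0..1} in lborel. (F s y)\<^sup>2 = (Z s y)\<^sup>2" by eventually_elim auto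
      then show "?E (F s) = ?E (Z s)"
        using L2[OF s] by (intro set_integral_cong_AE_set_borel(1)) (auto simp: L2_def intro: set_integrable_imp_set_borel_measurable)
    qed
  qed
  have E0: "?E (F 0) \<le> 1"
  proof -
    have "?E (F 0) \<le> (LINT y:{0..1::real}|lborel. 1)"
    proof (rule set_integral_mono_AE)
      show "set_integrable lborel {0..1} (\<lambda>y. (F 0 y)\<^sup>2)" using L2(1)[of 0] T by (simp add: L2_def)
      show "set_integrable lborel {0..1} (\<lambda>y::real. 1::real)" by (intro borel_integrable_atLeastAtMost') auto
      show "AE y\<in>{0..1} in lborel. (F 0 y)\<^sup>2 \<le> 1"
        using F(3) Z0 by eventually_elim (auto intro: power_le_one)
    qed
    then show ?thesis by (simp add: set_lebesgue_integral_def)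
  qed
  obtain d0 where d0: "d0 > 0" "\<And>s. s \<in> {0..T} \<Longrightarrow> \<bar>s - 0\<bar> < d0 \<Longrightarrow> ?E (F 0) \<le> 2 * ?E (F s) + 2"
    "\<And>s. s \<in> {0..T} \<Longrightarrow> \<bar>s - 0\<bar> < d0 \<Longrightarrow> ?E (F s) \<le> 2 * ?E (F 0) + 2"
    using L2_continuous_square_integral_close[OF F(1), of 0] T by (metis atLeastAtMost_iff less_imp_le order_refl)
  obtain d where d: "d > 0" "\<And>s. s \<in> {0..T} \<Longrightarrow> \<bar>s - t\<bar> < d \<Longrightarrow> ?E (Z t) \<le> 2 * ?E (Z s) + 2"
    "\<And>s. s \<in> {0..T} \<Longrightarrow> \<bar>s - t\<bar> < d \<Longrightarrow> ?E (Z s) \<le> 2 * ?E (Z t) + 2"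
    using L2_continuous_square_integral_close[OF cont t] by metis
  have decay: "AE s in lborel. s \<in> {0..T} \<longrightarrow> ?E (F s) = ?E (Z s) \<and>
      (AE t\<in>{0..T} in lborel. s \<le> t \<longrightarrow> ?E (Z t) \<le> ?E (Z s))"
    using FZ reactant_energy_nonincreasing[OF sol bc \<phi> K D T] by eventually_elim auto
  \<comment> \<open>Below t when t > 0, leaving room for a later time r; within d of t when t = 0,
    so that s itself is close enough to t.\<close>
  obtain s where s: "0 < s" "s < min (min d0 T) (if t = 0 then d else t)"
    "s \<in> {0..T} \<longrightarrow> ?E (F s) = ?E (Z s) \<and> (AE t\<in>{0..T} in lborel. s \<le> t \<longrightarrow> ?E (Z t) \<le> ?E (Z s))"
    using d0(1) d(1) T t by (auto intro: AE_obtain_in_Ioo[OF decay, of 0 "min (min d0 T) (if t = 0 then d else t)"])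
  then have sT: "s \<in> {0..T}" "s < d0" by auto
  \<comment> \<open>4 = 2 * 1 + 2, where the energy at time 0 is at most 1 because the initial
    values lie in [0,1].\<close>
  have Es: "?E (Z s) \<le> 4" using d0(3)[of s] sT s E0 by auto
  show ?thesis
  proof (cases "t = 0")
    case True
    then show ?thesis using d(2)[of s] s sT Es by auto
  next
    case False
    have "AE r\<in>{0..T} in lborel. s \<le> r \<longrightarrow> ?E (Z r) \<le> ?E (Z s)" using s sT by blast
    \<comment> \<open>A time r between this maximum and t is both after s, so its energy is at most
      4, and within d of t, which yields 2 * 4 + 2 = 10.\<close>
    moreover have "max s (t - d) < t" using False s d by simp
    ultimately obtain r where r: "max s (t - d) < r" "r < t" "r \<in> {0..T} \<longrightarrow> s \<le> r \<longrightarrow> ?E (Z r) \<le> ?E (Z s)"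
      by (rule AE_obtain_in_Ioo)
    then have "r \<in> {0..T}" "\<bar>r - t\<bar> < d" "s \<le> r" using t sT by auto
    then show ?thesis using d(2)[of r] r Es by auto
  qed
qed

theorem corollary1p7:
  shows "\<exists>C :: real \<Rightarrow> real \<Rightarrow> real \<Rightarrow> real \<Rightarrow> real \<Rightarrow> real \<Rightarrow> real \<Rightarrow> real \<Rightarrow> real \<Rightarrow> real \<Rightarrow> real \<Rightarrow> real.
    \<forall>(a::real) q m0 M0 D K \<mu> \<nu> T \<alpha> A \<theta>ign (\<phi> :: real \<Rightarrow> real)
      (v0 :: real \<Rightarrow> real) u0 \<theta>0 Z0 (v :: real \<Rightarrow> real \<Rightarrow> real) u \<theta> Z.
      0 < a \<and> 0 < \<mu> \<and> 0 < \<nu> \<and> 0 < q \<and> 0 < K \<and> 0 < D \<and> 0 < T \<and> 0 < m0 \<and>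
      0 < \<theta>ign \<and> 0 < A \<and> reaction_rate \<alpha> A \<theta>ign \<phi> \<and> Linf {0<..} \<phi> \<and>
      Hk 1 v0 \<and> W1inf v0 \<and> Hk 1 u0 \<and> Hk 1 \<theta>0 \<and> Hk 1 Z0 \<and>
      initial_data a \<mu> m0 M0 v0 u0 \<theta>0 Z0 \<and>
      generalised_solution a \<mu> \<nu> q K D \<phi> T v0 u0 \<theta>0 Z0 v u \<theta> Z \<and>
      boundary_conditions T u \<theta> Z \<and>
      L2_continuous T Z \<longrightarrow>
      (\<forall>t\<in>{0..T}. Ent (Z t) \<le>
         C a q m0 M0 D K \<mu> \<nu> T (Linf_norm {0<..} \<phi>) (data_norm v0 u0 \<theta>0 Z0))"
proof (rule exI[of _ "\<lambda>_ _ _ _ _ _ _ _ _ _ _. 22"], intro allI impI ballI, elim conjE)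
  \<comment> \<open>The witness 22 is 2 * 10 + 2: the energy bound 10 inserted into the entropy
    inequality.\<close>
  fix a q m0 M0 D K \<mu> \<nu> T \<alpha> A \<theta>ign t :: real and \<phi> v0 u0 \<theta>0 Z0 :: "real \<Rightarrow> real"
    and v u \<theta> Z :: "real \<Rightarrow> real \<Rightarrow> real"
  assume pos: "0 < K" "0 < D" "0 < T" and \<phi>: "reaction_rate \<alpha> A \<theta>ign \<phi>"
    and data: "initial_data a \<mu> m0 M0 v0 u0 \<theta>0 Z0"
    and sol: "generalised_solution a \<mu> \<nu> q K D \<phi> T v0 u0 \<theta>0 Z0 v u \<theta> Z"
    and bc: "boundary_conditions T u \<theta> Z" and cont: "L2_continuous T Z" and t: "t \<in> {0..T}"
  have "AE y\<in>{0..1} in lborel. m0 \<le> 1 / v0 y \<and> 1 / v0 y \<le> M0 \<and> m0 \<le> \<theta>0 y \<and> \<theta>0 y \<le> M0 \<and> 0 \<le> Z0 y \<and> Z0 y \<le> 1"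
    using data by (simp add: initial_data_def)
  then have "AE y\<in>{0..1} in lborel. 0 \<le> Z0 y \<and> Z0 y \<le> 1" by eventually_elim auto
  then have "(LINT y:{0..1}|lborel. (Z t y)\<^sup>2) \<le> 10"
    using reactant_square_integral_le[OF sol bc reaction_rate_nonneg[OF \<phi>] pos _ cont t] by blast
  moreover have "L2 {0..1} (Z t)" using cont t by (simp add: L2_continuous_def)
  ultimately have "Ent (Z t) \<le> 2 * 10 + 2" by (intro Ent_le_square_integral)
  then show "Ent (Z t) \<le> 22" by simp
qed

end
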